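(* Suppose that $F:\mathbb{R}^n\to\mathbb{R}$ is given by $$F(x_1,x_2,\dots,x_n)=\sum_{i=1}^{n-1}x_i^2-x_n^2+c,$$ with $c\ge 1$, and let $\Omega\subset\mathbb{R}^n$ be a domain with $\partial\Omega=F^{-1}(1)$. Then there does not exist a compact minimal hypersurface with free boundary on $\partial\Omega$.
   Context: A hypersurface $\Sigma$ here is an immersed $(n-1)$-dimensional hypersurface with boundary, contained in $\Omega$ (up to its boundary), with $\partial\Sigma\subset\partial\Omega$; hypersurfaces on either side of the level set $F^{-1}(1)$ are considered. $\Sigma$ is minimal if its mean curvature vanishes. $\Sigma$ has free boundary on $\partial\Omega$ if it meets $\partial\Omega$ orthogonally along $\partial\Sigma$, that is, the outward unit conormal of $\partial\Sigma$ in $\Sigma$ coincides with the outward unit normal $\bar N$ of $\partial\Omega$ along $\partial\Sigma$, or equivalently $\langle \bar N,N\rangle=0$ along $\partial\Sigma$, where $N$ is the unit normal of $\Sigma$. For $c>1$ the set $F^{-1}(1)$ is a hyperboloid of two sheets, and for $c=1$ it is a cone.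
   Formalization: The dimension is assumed to be n ≥ 3; for n = 2 and c > 1 the claim fails, since the segment from (0,-√(c-1)) to (0,√(c-1)) is a compact minimal curve in {F > 1} meeting both branches of F=1 orthogonally. *)

theory Defs
  imports "HOL-Analysis.Analysis"
begin

section \<open>Smooth functions\<close>

text \<open>\<open>Ck_on k S f\<close> is meant for open \<open>S\<close>, where it says that \<open>f\<close> is \<open>k\<close> times continuously
  differentiable (for a finite-dimensional domain).\<close>

primrec Ck_on ::
  "nat \<Rightarrow> 'a::real_normed_vector set \<Rightarrow> ('a \<Rightarrow> 'b::real_normed_vector) \<Rightarrow> bool" where
  "Ck_on 0 S f \<longleftrightarrow> continuous_on S f"
| "Ck_on (Suc k) S f \<longleftrightarrow>
     f differentiable_on S \<and> (\<forall>v. Ck_on k S (\<lambda>x. frechet_derivative f (at x) v))"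

text \<open>For an arbitrary set \<open>S\<close>, in particular for a relatively open subset of a half-space,
  smoothness means that \<open>f\<close> extends to a smooth function near every point of \<open>S\<close>.\<close>

definition smooth_on ::
  "'a::real_normed_vector set \<Rightarrow> ('a \<Rightarrow> 'b::real_normed_vector) \<Rightarrow> bool" where
  "smooth_on S f \<longleftrightarrow>
     (\<forall>x\<in>S. \<exists>U g. open U \<and> x \<in> U \<and> (\<forall>k. Ck_on k U g) \<and> (\<forall>y\<in>S \<inter> U. g y = f y))"


section \<open>Smooth manifolds with boundary\<close>

text \<open>The charts of a manifold with boundary take values in the closed half-space on which the
  coordinate \<open>j\<close> is nonnegative. A chart is a pair of its domain and the chart map.\<close>

definition half_space :: "'d \<Rightarrow> (real^'d) set" where
  "half_space j = {y. 0 \<le> y $ j}"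

type_synonym ('m, 'd) chart = "'m set \<times> ('m \<Rightarrow> real^'d)"

definition is_chart :: "'d \<Rightarrow> 'm topology \<Rightarrow> ('m, 'd::finite) chart \<Rightarrow> bool" where
  "is_chart j M = (\<lambda>(U, \<phi>).
     openin M U \<and> openin (top_of_set (half_space j)) (\<phi> ` U) \<and>
     homeomorphic_map (subtopology M U) (top_of_set (\<phi> ` U)) \<phi>)"

definition smooth_atlas :: "'d \<Rightarrow> 'm topology \<Rightarrow> ('m, 'd::finite) chart set \<Rightarrow> bool" where
  "smooth_atlas j M A \<longleftrightarrow>
     (\<forall>C\<in>A. is_chart j M C) \<and>
     (\<Union>(U, \<phi>)\<in>A. U) = topspace M \<and>
     (\<forall>(U, \<phi>)\<in>A. \<forall>(V, \<psi>)\<in>A. smooth_on (\<phi> ` (U \<inter> V)) (\<psi> \<circ> inv_into U \<phi>))"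

definition manifold_with_boundary ::
  "'d \<Rightarrow> 'm topology \<Rightarrow> ('m, 'd::finite) chart set \<Rightarrow> bool" where
  "manifold_with_boundary j M A \<longleftrightarrow>
     Hausdorff_space M \<and> second_countable M \<and> smooth_atlas j M A"

definition manifold_boundary :: "'d \<Rightarrow> ('m, 'd::finite) chart set \<Rightarrow> 'm set" where
  "manifold_boundary j A = {p. \<exists>(U, \<phi>)\<in>A. p \<in> U \<and> \<phi> p $ j = 0}"


section \<open>Local parametrizations\<close>

text \<open>The map \<open>f\<close> is used through its local expressions \<open>f \<circ> inv_into U \<phi>\<close> on \<open>\<phi> ` U\<close>. All derivatives are
  taken within \<open>V = \<phi> ` U\<close>; they are uniquely determined even at the boundary of the half-space.\<close>

definition local_expr ::
  "('m, 'd::finite) chart \<Rightarrow> ('m \<Rightarrow> real^'n::finite) \<Rightarrow> real^'d \<Rightarrow> real^'n" where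
  "local_expr C f = f \<circ> inv_into (fst C) (snd C)"

definition partial ::
  "(real^'d) set \<Rightarrow> (real^'d::finite \<Rightarrow> real^'n::finite) \<Rightarrow> 'd \<Rightarrow> real^'d \<Rightarrow> real^'n" where
  "partial V X i y = frechet_derivative X (at y within V) (axis i 1)"

definition first_form ::
  "(real^'d) set \<Rightarrow> (real^'d::finite \<Rightarrow> real^'n::finite) \<Rightarrow> real^'d \<Rightarrow> real^'d^'d" where
  "first_form V X y = (\<chi> i k. partial V X i y \<bullet> partial V X k y)"

definition second_form ::
  "(real^'d) set \<Rightarrow> (real^'d::finite \<Rightarrow> real^'n::finite) \<Rightarrow> real^'n \<Rightarrow> real^'d \<Rightarrow> real^'d^'d" where
  "second_form V X N y = (\<chi> i k. partial V (partial V X i) k y \<bullet> N)"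

definition unit_normal ::
  "(real^'d) set \<Rightarrow> (real^'d::finite \<Rightarrow> real^'n::finite) \<Rightarrow> real^'d \<Rightarrow> real^'n \<Rightarrow> bool" where
  "unit_normal V X y N \<longleftrightarrow> norm N = 1 \<and> (\<forall>i. partial V X i y \<bullet> N = 0)"

text \<open>The trace of the shape operator at \<open>y\<close> with respect to the unit normal \<open>N\<close>; the normalization
  by the dimension is omitted.\<close>

definition mean_curvature ::
  "(real^'d) set \<Rightarrow> (real^'d::finite \<Rightarrow> real^'n::finite) \<Rightarrow> real^'n \<Rightarrow> real^'d \<Rightarrow> real" where
  "mean_curvature V X N y = trace (matrix_inv (first_form V X y) ** second_form V X N y)"

text \<open>A tangent vector at a boundary point is outward if its coordinate \<open>j\<close> is negative, and tangent to
  the boundary if its coordinate \<open>j\<close> vanishes.\<close>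

definition outward_unit_conormal ::
  "'d \<Rightarrow> (real^'d) set \<Rightarrow> (real^'d::finite \<Rightarrow> real^'n::finite) \<Rightarrow> real^'d \<Rightarrow> real^'n \<Rightarrow> bool" where
  "outward_unit_conormal j V X y \<nu> \<longleftrightarrow>
     norm \<nu> = 1 \<and>
     (\<exists>w. w $ j < 0 \<and> \<nu> = frechet_derivative X (at y within V) w) \<and>
     (\<forall>u. u $ j = 0 \<longrightarrow> frechet_derivative X (at y within V) u \<bullet> \<nu> = 0)"


section \<open>Free boundary minimal hypersurfaces\<close>

definition immersed_hypersurface ::
  "'d \<Rightarrow> 'm topology \<Rightarrow> ('m, 'd::finite) chart set \<Rightarrow> ('m \<Rightarrow> real^'n::finite) \<Rightarrow> bool" where
  "immersed_hypersurface j M A f \<longleftrightarrow>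
     CARD('n) = CARD('d) + 1 \<and> topspace M \<noteq> {} \<and> manifold_with_boundary j M A \<and>
     (\<forall>(U, \<phi>)\<in>A. smooth_on (\<phi> ` U) (local_expr (U, \<phi>) f) \<and>
        (\<forall>y\<in>\<phi> ` U. inj (frechet_derivative (local_expr (U, \<phi>) f) (at y within \<phi> ` U))))"

text \<open>A unit normal is only needed pointwise, so no orientability is required; replacing \<open>N\<close> by \<open>- N\<close>
  changes the sign of the mean curvature.\<close>

definition minimal_hypersurface ::
  "'d \<Rightarrow> 'm topology \<Rightarrow> ('m, 'd::finite) chart set \<Rightarrow> ('m \<Rightarrow> real^'n::finite) \<Rightarrow> bool" where
  "minimal_hypersurface j M A f \<longleftrightarrow>
     immersed_hypersurface j M A f \<and>
     (\<forall>(U, \<phi>)\<in>A. \<forall>y\<in>\<phi> ` U. \<forall>N. unit_normal (\<phi> ` U) (local_expr (U, \<phi>) f) y N \<longrightarrow>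
        mean_curvature (\<phi> ` U) (local_expr (U, \<phi>) f) N y = 0)"

text \<open>The outward unit normal is the normalized gradient of a local defining function of \<open>\<Omega>\<close>. It exists
  only where the boundary of \<open>\<Omega>\<close> is a smooth hypersurface with \<open>\<Omega>\<close> on one side of it; the vertex of a
  cone has none.\<close>

definition outward_unit_normal :: "(real^'n::finite) set \<Rightarrow> real^'n \<Rightarrow> real^'n \<Rightarrow> bool" where
  "outward_unit_normal \<Omega> p \<nu> \<longleftrightarrow>
     norm \<nu> = 1 \<and>
     (\<exists>U (g :: real^'n \<Rightarrow> real) \<mu>. open U \<and> p \<in> U \<and> smooth_on U g \<and> g p = 0 \<and>
        \<Omega> \<inter> U = {x \<in> U. g x < 0} \<and> frontier \<Omega> \<inter> U = {x \<in> U. g x = 0} \<and>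
        \<mu> > 0 \<and> (GDERIV g p :> \<mu> *\<^sub>R \<nu>))"

definition contained_up_to_boundary ::
  "'d \<Rightarrow> 'm topology \<Rightarrow> ('m, 'd::finite) chart set \<Rightarrow> ('m \<Rightarrow> real^'n::finite) \<Rightarrow>
   (real^'n) set \<Rightarrow> bool" where
  "contained_up_to_boundary j M A f \<Omega> \<longleftrightarrow>
     f ` (topspace M - manifold_boundary j A) \<subseteq> \<Omega> \<and> f ` manifold_boundary j A \<subseteq> frontier \<Omega>"

definition free_boundary ::
  "'d \<Rightarrow> ('m, 'd::finite) chart set \<Rightarrow> ('m \<Rightarrow> real^'n::finite) \<Rightarrow> (real^'n) set \<Rightarrow> bool" where
  "free_boundary j A f \<Omega> \<longleftrightarrow>
     (\<forall>(U, \<phi>)\<in>A. \<forall>p\<in>U. \<phi> p $ j = 0 \<longrightarrow>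
        (\<exists>\<nu>. outward_unit_conormal j (\<phi> ` U) (local_expr (U, \<phi>) f) (\<phi> p) \<nu> \<and>
             outward_unit_normal \<Omega> (f p) \<nu>))"

definition compact_free_boundary_minimal_hypersurface ::
  "'d \<Rightarrow> 'm topology \<Rightarrow> ('m, 'd::finite) chart set \<Rightarrow> ('m \<Rightarrow> real^'n::finite) \<Rightarrow>
   (real^'n) set \<Rightarrow> bool" where
  "compact_free_boundary_minimal_hypersurface j M A f \<Omega> \<longleftrightarrow>
     compact_space M \<and> minimal_hypersurface j M A f \<and>
     contained_up_to_boundary j M A f \<Omega> \<and> free_boundary j A f \<Omega>"

end

theory Submission
  imports Defs
begin

text \<open>
  The proof is a maximum principle for \<open>h x = x \<bullet> T x\<close> with \<open>T = diag(1,\<dots>,1,s)\<close>, \<open>s \<ge> 0\<close>. At a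
  critical point of \<open>h\<close> on a minimal hypersurface \<open>T x\<close> is normal, so the Laplacian of \<open>h\<close> is
  \<open>2 \<Sum>\<^sub>a e\<^sub>a \<bullet> T e\<^sub>a\<close> for an orthonormal tangent frame; in dimension at least 2 this is positive, and
  interior maxima are impossible. The hypersurface is split into the parts where \<open>F > 1\<close> and
  \<open>F < 1\<close>. At a boundary point \<open>x\<close> in the closure of one part the outward conormal is the unit normal
  of the quadric pointing away from that part, hence a multiple \<open>\<nu>\<close> of \<open>B x\<close> with
  \<open>B = diag(1,\<dots>,1,-1)\<close>. With \<open>s = 0\<close> on \<open>F > 1\<close> and \<open>s = 2\<close> on \<open>F < 1\<close> one gets \<open>\<nu> \<bullet> T x < 0\<close>, so \<open>h\<close>
  increases in the inward direction and has no boundary maximum either, except where \<open>h x = 0\<close>; a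
  maximal value \<open>0\<close> would make \<open>h\<close> vanish identically on that part, which again gives interior maxima.
\<close>

section \<open>Second derivative test and derivatives of local parametrizations\<close>

lemma snd_derivative_nonpos_if_local_max:
  fixes f f' :: "real \<Rightarrow> real"
  assumes f': "\<forall>\<^sub>F t in nhds 0. (f has_real_derivative f' t) (at t)"
    and f'': "(f' has_real_derivative b) (at 0)"
    and max: "\<forall>\<^sub>F t in nhds 0. f t \<le> f 0"
  shows "f' 0 = 0" and "b \<le> 0"
proof -
  obtain d where d: "d > 0"
    and f'd: "\<And>t. \<bar>t\<bar> < d \<Longrightarrow> (f has_real_derivative f' t) (at t)"
    and maxd: "\<And>t. \<bar>t\<bar> < d \<Longrightarrow> f t \<le> f 0"
    using eventually_conj[OF f' max] unfolding eventually_nhds_metric dist_real_def by auto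
  show f'0: "f' 0 = 0"
    by (rule DERIV_local_max[of f "f' 0" 0 d]) (use d f'd maxd in auto)
  show "b \<le> 0"
  proof (rule ccontr)
    assume "\<not> b \<le> 0"
    \<comment> \<open>Since \<open>f' 0 = 0\<close>, a positive \<open>b\<close> makes
      \<open>f'\<close> positive just to the right of 0, and the mean value theorem then lifts
      \<open>f\<close> above \<open>f 0\<close>.\<close>
    then obtain e where e: "e > 0" "\<And>h. 0 < h \<Longrightarrow> h < e \<Longrightarrow> f' 0 < f' h"
      using DERIV_pos_inc_right[OF f''] by auto
    define t where "t = min d e / 2"
    have t: "0 < t" "t < d" "t < e" using d e(1) by (auto simp: t_def)
    obtain z where z: "0 < z" "z < t" "f t - f 0 = (t - 0) * f' z"
      using MVT2[of 0 t f f'] t f'd by auto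
    have "f' z > 0" using e(2)[of z] z t f'0 by auto
    then have "f t > f 0" using z(3) t(1) by (metis diff_gt_0_iff_gt diff_zero mult_pos_pos)
    then show False using maxd[of t] t by auto
  qed
qed

lemma linear_axis_expansion:
  fixes L :: "real^'d::finite \<Rightarrow> 'b::real_vector"
  assumes "linear L"
  shows "L v = (\<Sum>i\<in>UNIV. v $ i *\<^sub>R L (axis i 1))"
proof -
  have "L v = L (\<Sum>i\<in>UNIV. v $ i *\<^sub>R axis i 1)"
    using basis_expansion[of v] by (simp add: scalar_mult_eq_scaleR)
  then show ?thesis
    using assms by (simp add: linear_sum linear_cmul)
qed

text \<open>Partial derivatives are taken within \<open>V\<close>, and smoothness on
  \<open>V\<close> only provides a local extension \<open>g\<close>. On the open set
  \<open>interior V \<inter> U\<close> derivatives within \<open>V\<close> are full derivatives and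
  \<open>X\<close> agrees with \<open>g\<close>, so \<open>X\<close> inherits the second-order
  smoothness of \<open>g\<close>.\<close>

lemma smooth_on_interior_derivatives:
  fixes X :: "real^'d::finite \<Rightarrow> real^'n::finite"
  assumes X: "smooth_on V X" and y: "y \<in> interior V"
  obtains S where "open S" "y \<in> S" "S \<subseteq> V"
    "\<And>z. z \<in> S \<Longrightarrow> (X has_derivative (\<lambda>v. \<Sum>i\<in>UNIV. v $ i *\<^sub>R partial V X i z)) (at z)"
    "\<And>i. (partial V X i has_derivative
            (\<lambda>v. \<Sum>k\<in>UNIV. v $ k *\<^sub>R partial V (partial V X i) k y)) (at y)"
proof -
  have "y \<in> V"
    using y interior_subset by blast
  then obtain U g where U: "open U" "y \<in> U" and g: "\<And>k. Ck_on k U g"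
    and gX: "\<And>z. z \<in> V \<inter> U \<Longrightarrow> g z = X z"
    using X[unfolded smooth_on_def, rule_format, of y] by auto
  define S where "S = interior V \<inter> U"
  have S: "open S" "y \<in> S" "S \<subseteq> V" "S \<subseteq> U"
    using U y interior_subset[of V] by (auto simp: S_def)
  have within: "at z within V = at z" if "z \<in> S" for z
    using that at_within_interior[of z V] by (auto simp: S_def)
  have der: "(h has_derivative (\<lambda>v. \<Sum>i\<in>UNIV. v $ i *\<^sub>R partial V h i z)) (at z)"
    if "h differentiable (at z)" "z \<in> S" for h :: "real^'d \<Rightarrow> real^'n" and z
  proof -
    let ?L = "frechet_derivative h (at z)"
    have L: "(h has_derivative ?L) (at z)"
      using that(1) frechet_derivative_works by blast
    have "?L = (\<lambda>v. \<Sum>i\<in>UNIV. v $ i *\<^sub>R partial V h i z)"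
      unfolding partial_def within[OF that(2)]
      by (rule ext) (rule linear_axis_expansion[OF has_derivative_linear[OF L]])
    then show ?thesis using L by metis
  qed
  have g2: "g differentiable_on U"
    "\<And>v. (\<lambda>x. frechet_derivative g (at x) v) differentiable_on U"
    using g[of "Suc (Suc 0)"] by auto
  have Xg: "(X has_derivative frechet_derivative g (at z)) (at z)" if "z \<in> S" for z
  proof -
    have "g differentiable (at z)"
      using g2(1) U(1) that S(4) by (metis at_within_open differentiable_on_def subsetD)
    then have "(g has_derivative frechet_derivative g (at z)) (at z)"
      using frechet_derivative_works by blast
    then show ?thesis
      by (rule has_derivative_transform_within_open[OF _ S(1) that]) (use gX S in auto)
  qed
  have pX: "partial V X i z = frechet_derivative g (at z) (axis i 1)" if "z \<in> S" for i z
    using frechet_derivative_at[OF Xg[OF that]] by (simp add: partial_def within[OF that])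
  have pd: "partial V X i differentiable (at y)" for i
  proof -
    have "(\<lambda>x. frechet_derivative g (at x) (axis i 1)) differentiable (at y)"
      using g2(2) U by (metis at_within_open differentiable_on_def)
    then obtain D where "((\<lambda>x. frechet_derivative g (at x) (axis i 1)) has_derivative D) (at y)"
      by (auto simp: differentiable_def)
    then have "(partial V X i has_derivative D) (at y)"
      by (rule has_derivative_transform_within_open[OF _ S(1,2)]) (use pX in auto)
    then show ?thesis by (auto simp: differentiable_def)
  qed
  show ?thesis
  proof (rule that[OF S(1-3)])
    show "(X has_derivative (\<lambda>v. \<Sum>i\<in>UNIV. v $ i *\<^sub>R partial V X i z)) (at z)" if "z \<in> S" for z
      by (rule der[OF _ that]) (use Xg[OF that] differentiable_def in blast)
    show "(partial V X i has_derivative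
            (\<lambda>v. \<Sum>k\<in>UNIV. v $ k *\<^sub>R partial V (partial V X i) k y)) (at y)" for i
      by (rule der[OF pd S(2)])
  qed
qed

section \<open>Traces in an orthonormal frame\<close>

text \<open>The hypothesis says W^T G W = 1 for the matrix W with columns \<open>w a\<close>. Hence
  the inverse of G is W W^T, and cyclicity of the trace turns tr (W W^T A) into tr (W^T A
  W).\<close>

lemma trace_matrix_inv_mult:
  fixes G A :: "real^'d::finite^'d" and w :: "'d \<Rightarrow> real^'d"
  assumes "\<And>a b. w a \<bullet> (G *v w b) = (if a = b then 1 else 0)"
  shows "trace (matrix_inv G ** A) = (\<Sum>a\<in>UNIV. w a \<bullet> (A *v w a))"
proof -
  define W :: "real^'d^'d" where "W = (\<chi> i a. w a $ i)"
  have col: "(A *v w b) $ i = (A ** W) $ i $ b" for A :: "real^'d^'d" and i b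
    by (simp add: W_def matrix_vector_mult_def matrix_matrix_mult_def)
  have ent: "w a \<bullet> (A *v w b) = (transpose W ** (A ** W)) $ a $ b" for A :: "real^'d^'d" and a b
    by (simp add: inner_vec_def col matrix_matrix_mult_def[of "transpose W"])
       (simp add: transpose_def W_def)
  have "transpose W ** (G ** W) = mat 1"
    using assms by (simp add: vec_eq_iff mat_def flip: ent)
  then have "(G ** W) ** transpose W = mat 1"
    by (simp add: matrix_left_right_inverse)
  then have *: "G ** (W ** transpose W) = mat 1"
    by (simp add: matrix_mul_assoc)
  \<comment> \<open>\<open>matrix_inv\<close> chooses a two-sided inverse; W W^T witnesses that
    there is one to choose.\<close>
  have "matrix_inv G ** G = mat 1"
    unfolding matrix_inv_def
    by (rule someI2[of _ "W ** transpose W"]) (use * matrix_left_right_inverse in auto)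
  then have "matrix_inv G = W ** transpose W"
    using * by (metis matrix_mul_assoc matrix_mul_lid matrix_mul_rid)
  then have "trace (matrix_inv G ** A) = trace (W ** (transpose W ** A))"
    by (simp add: matrix_mul_assoc)
  also have "\<dots> = trace ((transpose W ** A) ** W)"
    by (rule trace_mul_sym)
  also have "\<dots> = (\<Sum>a\<in>UNIV. w a \<bullet> (A *v w a))"
    by (simp add: trace_def ent matrix_mul_assoc)
  finally show ?thesis .
qed

text \<open>Supplies a frame that is orthonormal for the metric pulled back by \<open>L\<close>:
  injectivity makes the range \<open>CARD('d)\<close>-dimensional, so an orthonormal basis of it can
  be indexed by \<open>'d\<close> and lifted.\<close>

lemma orthonormal_preimages:
  fixes L :: "real^'d::finite \<Rightarrow> 'b::euclidean_space"
  assumes "linear L" "inj L"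
  obtains w :: "'d \<Rightarrow> real^'d" where "\<And>a b. L (w a) \<bullet> L (w b) = (if a = b then 1 else 0)"
proof -
  have "subspace (range L)" "dim (range L) = CARD('d)"
    using assms by (auto simp: linear_subspace_image dim_image_eq[OF assms(1)])
  then obtain B where B: "B \<subseteq> range L" "pairwise orthogonal B" "\<And>x. x \<in> B \<Longrightarrow> norm x = 1"
     "independent B" "card B = CARD('d)"
    using orthonormal_basis_subspace[of "range L"] by metis
  have "finite B" using B(4) independent_imp_finite by blast
  then obtain e where e: "bij_betw e (UNIV :: 'd set) B"
    using finite_same_card_bij[of "UNIV :: 'd set" B] B(5) by auto
  have "\<exists>x. L x = e a" for a
    using e B(1) by (metis UNIV_I bij_betwE rangeE subsetD)
  then obtain w where w: "\<And>a. L (w a) = e a" by metis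
  have "e a \<bullet> e b = (if a = b then 1 else 0)" for a b
  proof (cases "a = b")
    case True
    then show ?thesis using B(3)[of "e b"] bij_betwE[OF e] by (simp add: norm_eq_1)
  next
    case False
    then have "e a \<noteq> e b" using e by (auto simp: bij_betw_def inj_def)
    then show ?thesis
      using False B(2) bij_betwE[OF e] by (auto simp: pairwise_def orthogonal_def)
  qed
  then show ?thesis using that w by metis
qed

text \<open>The quadratic form of the level sets is \<open>x \<bullet> stretch l (-1) x\<close>: the function \<open>F\<close> equals it up to \<open>c\<close>.\<close>

definition stretch :: "'n \<Rightarrow> real \<Rightarrow> real^'n::finite \<Rightarrow> real^'n" where
  "stretch l s x = x + ((s - 1) * x $ l) *\<^sub>R axis l 1"

lemma inner_stretch: "x \<bullet> stretch l s y = x \<bullet> y + (s - 1) * x $ l * y $ l"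
  by (simp add: stretch_def inner_add_right inner_axis)

lemma inner_stretch_commute: "x \<bullet> stretch l s y = y \<bullet> stretch l s x"
  by (simp add: inner_stretch inner_commute)

lemma bounded_linear_stretch: "bounded_linear (stretch l s)"
  unfolding linear_conv_bounded_linear[symmetric]
  by (rule linearI) (simp_all add: stretch_def algebra_simps)

section \<open>The maximum principle at interior points\<close>

lemma has_vector_derivative_along_line:
  assumes "(g has_derivative D) (at (y + t *\<^sub>R v))"
  shows "((\<lambda>t. g (y + t *\<^sub>R v)) has_vector_derivative D v) (at t)"
proof -
  have "((\<lambda>t. y + t *\<^sub>R v) has_derivative (\<lambda>h. h *\<^sub>R v)) (at t)"
    by (auto intro!: derivative_eq_intros)
  from has_derivative_compose[OF this assms]
  show ?thesis
    by (simp add: has_vector_derivative_def linear_cmul[OF has_derivative_linear[OF assms]])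
qed

lemma has_real_derivative_inner_stretch:
  assumes "(f has_vector_derivative f') (at t within S)" "(g has_vector_derivative g') (at t within S)"
  shows "((\<lambda>t. f t \<bullet> stretch l s (g t)) has_real_derivative
            (f' \<bullet> stretch l s (g t) + g' \<bullet> stretch l s (f t))) (at t within S)"
  using bounded_bilinear.has_vector_derivative[OF bounded_bilinear_inner assms(1)
      bounded_linear.has_vector_derivative[OF bounded_linear_stretch assms(2), of l s]]
  by (simp add: has_real_derivative_iff_has_vector_derivative add.commute inner_stretch_commute[of g'])

text \<open>Apply the second derivative test to the form along the line
  \<open>y + t *\<^sub>R v\<close>. As the stretch T is symmetric, the first derivative is 2
  \<gamma>' \<bullet> T \<gamma> and the second is 2 (\<gamma>'' \<bullet> T \<gamma> + \<gamma>'
  \<bullet> T \<gamma>'). Straight parameter lines can replace geodesics: the difference in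
  acceleration is tangential, and T (X y) is normal by the first claim.\<close>

lemma interior_local_max_imp:
  fixes X :: "real^'d::finite \<Rightarrow> real^'n::finite"
  assumes X: "smooth_on V X" and y: "y \<in> interior V"
    and max: "\<forall>\<^sub>F z in nhds y. X z \<bullet> stretch l s (X z) \<le> X y \<bullet> stretch l s (X y)"
  defines "L \<equiv> \<lambda>v. \<Sum>i\<in>UNIV. v $ i *\<^sub>R partial V X i y"
  shows "L v \<bullet> stretch l s (X y) = 0"
    and "L v \<bullet> stretch l s (L v) +
      (\<Sum>i\<in>UNIV. v $ i *\<^sub>R (\<Sum>k\<in>UNIV. v $ k *\<^sub>R partial V (partial V X i) k y)) \<bullet> stretch l s (X y) \<le> 0"
proof -
  obtain S where S: "open S" "y \<in> S" "S \<subseteq> V"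
    "\<And>z. z \<in> S \<Longrightarrow> (X has_derivative (\<lambda>v. \<Sum>i\<in>UNIV. v $ i *\<^sub>R partial V X i z)) (at z)"
    "\<And>i. (partial V X i has_derivative
            (\<lambda>v. \<Sum>k\<in>UNIV. v $ k *\<^sub>R partial V (partial V X i) k y)) (at y)"
    by (rule smooth_on_interior_derivatives[OF X y]) (rule that)
  define \<gamma> where "\<gamma> = (\<lambda>t. X (y + t *\<^sub>R v))"
  define \<gamma>' where "\<gamma>' = (\<lambda>t. \<Sum>i\<in>UNIV. v $ i *\<^sub>R partial V X i (y + t *\<^sub>R v))"
  define \<gamma>'' where "\<gamma>'' = (\<Sum>i\<in>UNIV. v $ i *\<^sub>R (\<Sum>k\<in>UNIV. v $ k *\<^sub>R partial V (partial V X i) k y))"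
  have "isCont (\<lambda>t. y + t *\<^sub>R v) 0"
    by (intro continuous_intros)
  then have line: "filterlim (\<lambda>t. y + t *\<^sub>R v) (nhds y) (nhds 0)"
    using tendsto_at_iff_tendsto_nhds[of "\<lambda>t. y + t *\<^sub>R v" 0] by (simp add: isCont_def)
  have "\<forall>\<^sub>F z in nhds y. z \<in> S"
    using S(1,2) by (rule eventually_nhds_in_open)
  from eventually_compose_filterlim[OF this line]
  have near: "\<forall>\<^sub>F t in nhds 0. y + t *\<^sub>R v \<in> S" .
  have d1: "(\<gamma> has_vector_derivative \<gamma>' t) (at t)" if "y + t *\<^sub>R v \<in> S" for t
    unfolding \<gamma>_def \<gamma>'_def
    using has_vector_derivative_along_line[OF S(4)[OF that]] .
  have d2: "(\<gamma>' has_vector_derivative \<gamma>'') (at 0)"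
    unfolding \<gamma>'_def \<gamma>''_def
    by (intro has_vector_derivative_sum bounded_linear.has_vector_derivative[OF bounded_linear_scaleR_right]
        has_vector_derivative_along_line) (use S(5) in auto)
  let ?H = "\<lambda>t. \<gamma> t \<bullet> stretch l s (\<gamma> t)" and ?H' = "\<lambda>t. 2 * (\<gamma>' t \<bullet> stretch l s (\<gamma> t))"
  have H: "\<forall>\<^sub>F t in nhds 0. (?H has_real_derivative ?H' t) (at t)"
    using near
  proof eventually_elim
    case (elim t)
    show ?case using has_real_derivative_inner_stretch[OF d1[OF elim] d1[OF elim], of l s] by simp
  qed
  have "y + 0 *\<^sub>R v \<in> S" using S(2) by simp
  from DERIV_cmult[OF has_real_derivative_inner_stretch[OF d2 d1[OF this], of l s], of 2]
  have H': "(?H' has_real_derivative 2 * (\<gamma>'' \<bullet> stretch l s (\<gamma> 0) + \<gamma>' 0 \<bullet> stretch l s (\<gamma>' 0))) (at 0)" .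
  have "\<forall>\<^sub>F t in nhds 0. ?H t \<le> ?H 0"
    using eventually_compose_filterlim[OF max line] by (simp add: \<gamma>_def)
  note * = snd_derivative_nonpos_if_local_max[OF H H' this]
  have [simp]: "\<gamma> 0 = X y" "\<gamma>' 0 = L v"
    by (simp_all add: \<gamma>_def \<gamma>'_def L_def)
  show "L v \<bullet> stretch l s (X y) = 0" using *(1) by simp
  show "L v \<bullet> stretch l s (L v) +
      (\<Sum>i\<in>UNIV. v $ i *\<^sub>R (\<Sum>k\<in>UNIV. v $ k *\<^sub>R partial V (partial V X i) k y)) \<bullet> stretch l s (X y) \<le> 0"
    using *(2) unfolding \<gamma>''_def by simp
qed

lemma quadratic_matrix_form:
  fixes v w :: "real^'d::finite" and b :: "'d \<Rightarrow> 'd \<Rightarrow> real"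
  shows "v \<bullet> ((\<chi> i k. b i k) *v w) = (\<Sum>i\<in>UNIV. \<Sum>k\<in>UNIV. v $ i * w $ k * b i k)"
  by (simp add: inner_vec_def matrix_vector_mult_def sum_distrib_left mult_ac)

text \<open>For s \<ge> 0 each summand is at least \<open>1 - (e a $ l)^2\<close>, the squared
  length of the component of \<open>e a\<close> orthogonal to the axis \<open>l\<close>. If all
  these lengths vanished, two distinct orthonormal vectors would both be multiples of that
  axis.\<close>

lemma sum_orthonormal_inner_stretch_pos:
  fixes e :: "'d::finite \<Rightarrow> real^'n::finite"
  assumes e: "\<And>a b. e a \<bullet> e b = (if a = b then 1 else 0)"
    and d: "CARD('d) \<ge> 2" and s: "s \<ge> 0"
  shows "(\<Sum>a\<in>UNIV. e a \<bullet> stretch l s (e a)) > 0"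
proof -
  have ge: "e a \<bullet> stretch l s (e a) \<ge> 1 - (e a $ l)^2" for a
    using e[of a a] s by (simp add: inner_stretch power2_eq_square algebra_simps)
  have perp: "(e a - (e a $ l) *\<^sub>R axis l 1) \<bullet> (e a - (e a $ l) *\<^sub>R axis l 1) = 1 - (e a $ l)^2" for a
    using e[of a a]
    by (simp add: inner_diff_left inner_diff_right inner_axis inner_axis' power2_eq_square)
  then have nonneg: "1 - (e a $ l)^2 \<ge> 0" for a
    by (metis inner_ge_zero)
  have "\<exists>a. 1 - (e a $ l)^2 > 0"
  proof (rule ccontr)
    assume "\<nexists>a. 1 - (e a $ l)^2 > 0"
    then have eq: "1 - (e a $ l)^2 = 0" for a using nonneg[of a] by (metis order_le_less)
    obtain a b :: 'd where ab: "a \<noteq> b"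
      using d card_le_Suc0_iff_eq[of "UNIV :: 'd set"] by force
    have "e a = (e a $ l) *\<^sub>R axis l 1" "e b = (e b $ l) *\<^sub>R axis l 1"
      using perp[of a] perp[of b] by (simp_all add: eq)
    then have "e a \<bullet> e b = e a $ l * e b $ l"
      by (metis inner_axis inner_scaleR_right inner_real_def mult.commute mult.right_neutral)
    then have "e a $ l = 0 \<or> e b $ l = 0" using e[of a b] ab by simp
    then show False using eq[of a] eq[of b] by auto
  qed
  then obtain a where "1 - (e a $ l)^2 > 0" by blast
  then have "0 < e a \<bullet> stretch l s (e a)" using ge[of a] by linarith
  moreover have "0 \<le> e b \<bullet> stretch l s (e b)" for b
    using ge[of b] nonneg[of b] by linarith
  ultimately show ?thesis
    by (intro sum_pos2[where i = a]) simp_all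
qed

text \<open>At a maximum the vector \<open>m\<close> is normal, so minimality makes the
  second-derivative terms against \<open>m\<close> cancel when summed over an orthonormal tangent
  frame. The sum of the second-order inequalities then contradicts the positivity of the trace of
  the stretch on the tangent space.\<close>

lemma minimal_imp_no_interior_local_max:
  fixes X :: "real^'d::finite \<Rightarrow> real^'n::finite"
  assumes d: "CARD('d) \<ge> 2" and s: "s \<ge> 0"
    and X: "smooth_on V X" and y: "y \<in> interior V"
    and inj: "inj (frechet_derivative X (at y within V))"
    and minimal: "\<And>N. unit_normal V X y N \<Longrightarrow> mean_curvature V X N y = 0"
  shows "\<not> (\<forall>\<^sub>F z in nhds y. X z \<bullet> stretch l s (X z) \<le> X y \<bullet> stretch l s (X y))"
proof
  assume max: "\<forall>\<^sub>F z in nhds y. X z \<bullet> stretch l s (X z) \<le> X y \<bullet> stretch l s (X y)"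
  define L where "L = (\<lambda>v. \<Sum>i\<in>UNIV. v $ i *\<^sub>R partial V X i y)"
  define m where "m = stretch l s (X y)"
  define D2 where "D2 = (\<lambda>v. \<Sum>i\<in>UNIV. v $ i *\<^sub>R (\<Sum>k\<in>UNIV. v $ k *\<^sub>R partial V (partial V X i) k y))"
  have c1: "L v \<bullet> m = 0" and c2: "L v \<bullet> stretch l s (L v) + D2 v \<bullet> m \<le> 0" for v
    using interior_local_max_imp[OF X y max] unfolding L_def m_def D2_def by blast+
  have LX: "(X has_derivative L) (at y)"
    unfolding L_def by (rule smooth_on_interior_derivatives[OF X y]) blast
  then have "frechet_derivative X (at y within V) = L"
    using at_within_interior[OF y] frechet_derivative_at by metis
  then have "inj L" using inj by simp
  then obtain w :: "'d \<Rightarrow> real^'d" where w: "\<And>a b. L (w a) \<bullet> L (w b) = (if a = b then 1 else 0)"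
    by (rule orthonormal_preimages[OF has_derivative_linear[OF LX]]) (rule that)
  have Laxis: "L (axis i 1) = partial V X i y" for i
    by (simp add: L_def axis_def if_distrib[of "\<lambda>c. c *\<^sub>R _"] cong: if_cong)
  \<comment> \<open>The first fundamental form is the metric pulled back by \<open>L\<close>, so
    \<open>w\<close> is a frame of the kind that evaluates traces against its inverse.\<close>
  have "w a \<bullet> (first_form V X y *v w b) = L (w a) \<bullet> L (w b)" for a b
    unfolding first_form_def quadratic_matrix_form L_def inner_sum_left
    by (simp add: inner_sum_right sum_distrib_left mult_ac)
  then have tr: "trace (matrix_inv (first_form V X y) ** A) = (\<Sum>a\<in>UNIV. w a \<bullet> (A *v w a))" for A
    using trace_matrix_inv_mult[of w] w by simp
  have sff: "w a \<bullet> (second_form V X N y *v w a) = D2 (w a) \<bullet> N" for N a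
    unfolding second_form_def quadratic_matrix_form D2_def
    by (simp add: inner_sum_left sum_distrib_left mult_ac)
  \<comment> \<open>Only unit normals enter the mean curvature: a nonzero \<open>m\<close> is
    normalized, and for \<open>m = 0\<close> the sum vanishes trivially.\<close>
  have "(\<Sum>a\<in>UNIV. D2 (w a) \<bullet> m) = 0"
  proof (cases "m = 0")
    case False
    have "unit_normal V X y (m /\<^sub>R norm m)"
      using False c1[of "axis _ 1"] by (auto simp: unit_normal_def Laxis)
    from minimal[OF this] have "(\<Sum>a\<in>UNIV. D2 (w a) \<bullet> (m /\<^sub>R norm m)) = 0"
      by (simp add: mean_curvature_def tr sff)
    then show ?thesis using False by (simp flip: sum_distrib_left sum_divide_distrib)
  qed simp
  moreover have "(\<Sum>a\<in>UNIV. L (w a) \<bullet> stretch l s (L (w a)) + D2 (w a) \<bullet> m) \<le> 0"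
    by (intro sum_nonpos c2)
  moreover have "(\<Sum>a\<in>UNIV. L (w a) \<bullet> stretch l s (L (w a))) > 0"
    by (rule sum_orthonormal_inner_stretch_pos) (use w d s in auto)
  ultimately show False by (simp add: sum.distrib)
qed

section \<open>The outward normal along the quadric\<close>

lemma smooth_on_imp_continuous_on:
  assumes "smooth_on S f"
  shows "continuous_on S f"
  unfolding continuous_on_eq_continuous_within
proof
  fix x assume x: "x \<in> S"
  then obtain U g where U: "open U" "x \<in> U" and g: "\<And>k. Ck_on k U g"
    and gf: "\<And>y. y \<in> S \<inter> U \<Longrightarrow> g y = f y"
    using assms[unfolded smooth_on_def, rule_format, OF x] by auto
  have "continuous_on U g" using g[of 0] by simp
  then have "continuous_on (S \<inter> U) f"
    using gf by (metis Int_lower2 continuous_on_cong continuous_on_subset)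
  then have "continuous (at x within S \<inter> U) f"
    using x U(2) by (simp add: continuous_on_eq_continuous_within)
  then show "continuous (at x within S) f"
    using at_within_nhd[of x U S "S \<inter> U"] U by (auto simp: continuous_within)
qed

lemma eventually_nhds_greater:
  fixes f :: "'a::t2_space \<Rightarrow> real"
  assumes "isCont f p" "f p > k"
  shows "\<forall>\<^sub>F x in nhds p. f x > k"
  using order_tendstoD(1)[OF assms(1)[unfolded isCont_def] assms(2)] assms(2)
  by (simp add: eventually_nhds_conv_at)

lemma inner_stretch_line:
  "(p + t *\<^sub>R v) \<bullet> stretch l s (p + t *\<^sub>R v) =
    p \<bullet> stretch l s p + t * (2 * (v \<bullet> stretch l s p) + t * (v \<bullet> stretch l s v))"
  by (simp add: inner_stretch inner_add_left inner_add_right inner_commute[of p v] power2_eq_square algebra_simps)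

lemma continuous_on_inner_stretch [continuous_intros]:
  assumes "continuous_on S f" "continuous_on S g"
  shows "continuous_on S (\<lambda>x. f x \<bullet> stretch l s (g x))"
  unfolding inner_stretch by (intro continuous_intros assms)

text \<open>To first order \<open>g\<close> changes by \<open>- t * \<mu>\<close> in the direction
  \<open>k *\<^sub>R w - \<nu>\<close>, since \<open>w\<close> is orthogonal to the gradient. The
  estimate is uniform for \<open>k\<close> between \<open>- K\<close> and \<open>K\<close> because
  these directions are bounded, so one \<open>t\<close> serves a whole segment.\<close>

lemma gderiv_neg_on_cone:
  fixes g :: "'a::real_inner \<Rightarrow> real"
  assumes g: "GDERIV g p :> \<mu> *\<^sub>R \<nu>" and g0: "g p = 0" and \<mu>: "\<mu> > 0"
    and \<nu>: "norm \<nu> = 1" and w: "w \<bullet> \<nu> = 0" and U: "open U" "p \<in> U"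
  shows "\<forall>\<^sub>F t in at_right 0. \<forall>k. \<bar>k\<bar> \<le> K \<longrightarrow>
           p + t *\<^sub>R (k *\<^sub>R w - \<nu>) \<in> U \<and> g (p + t *\<^sub>R (k *\<^sub>R w - \<nu>)) < 0"
proof -
  define C where "C = \<bar>K\<bar> * norm w + 1"
  have C: "C > 0" by (simp add: C_def add_nonneg_pos)
  \<comment> \<open>With this tolerance the error is at most half of the main term
    \<open>t * \<mu>\<close>.\<close>
  define e where "e = \<mu> / (2 * C)"
  have e: "e > 0" using C \<mu> by (simp add: e_def)
  obtain d where d: "d > 0" "\<And>y. norm (y - p) < d \<Longrightarrow>
      norm (g y - g p - (y - p) \<bullet> (\<mu> *\<^sub>R \<nu>)) \<le> e * norm (y - p)"
    using g e unfolding gderiv_def has_derivative_at_alt by blast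
  obtain r where r: "r > 0" "ball p r \<subseteq> U"
    using U open_contains_ball by blast
  have "\<forall>\<^sub>F t in at_right 0. 0 < t \<and> t < min d r / C"
    using C d(1) r(1) by (auto intro!: eventually_conj eventually_at_right_less eventually_at_rightI)
  then show ?thesis
  proof (eventually_elim, intro allI impI)
    fix t k :: real assume t: "0 < t \<and> t < min d r / C" and k: "\<bar>k\<bar> \<le> K"
    let ?v = "k *\<^sub>R w - \<nu>"
    have "norm ?v \<le> \<bar>k\<bar> * norm w + 1"
      using norm_triangle_ineq4[of "k *\<^sub>R w" \<nu>] \<nu> by simp
    also have "\<dots> \<le> C" using k by (auto simp: C_def intro!: mult_right_mono)
    finally have v: "norm ?v \<le> C" .
    then have tv: "norm (t *\<^sub>R ?v) \<le> t * C" using t by (simp add: mult_left_mono)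
    have tC: "t * C < d" "t * C < r" using t C by (simp_all add: field_simps)
    have inU: "p + t *\<^sub>R ?v \<in> U"
      using tv tC r(2) by (intro subsetD[OF r(2)]) (simp add: dist_norm)
    have "\<bar>g (p + t *\<^sub>R ?v) - (t *\<^sub>R ?v) \<bullet> (\<mu> *\<^sub>R \<nu>)\<bar> \<le> e * norm (t *\<^sub>R ?v)"
      using d(2)[of "p + t *\<^sub>R ?v"] tv tC g0 by simp
    moreover have "(t *\<^sub>R ?v) \<bullet> (\<mu> *\<^sub>R \<nu>) = - t * \<mu>"
      using w \<nu> by (simp add: inner_diff_left norm_eq_1)
    moreover have "e * norm (t *\<^sub>R ?v) \<le> e * (t * C)"
      using tv e by (intro mult_left_mono) auto
    moreover have "e * (t * C) = t * \<mu> / 2" using C by (simp add: e_def field_simps)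
    ultimately have "g (p + t *\<^sub>R ?v) \<le> - t * \<mu> + t * \<mu> / 2" by linarith
    also have "\<dots> < 0" using t \<mu> by simp
    finally show "p + t *\<^sub>R ?v \<in> U \<and> g (p + t *\<^sub>R ?v) < 0" using inU by simp
  qed
qed

lemma eventually_at_right_line_pos:
  assumes "v \<bullet> stretch l s p > 0"
  shows "\<forall>\<^sub>F t in at_right 0. (p + t *\<^sub>R v) \<bullet> stretch l s (p + t *\<^sub>R v) > p \<bullet> stretch l s p"
proof -
  let ?f = "\<lambda>t. 2 * (v \<bullet> stretch l s p) + t * (v \<bullet> stretch l s v)"
  have "isCont ?f 0" by (intro continuous_intros)
  then have "\<forall>\<^sub>F t in nhds 0. ?f t > 0"
    by (rule eventually_nhds_greater) (use assms in simp)
  then have "\<forall>\<^sub>F t in at_right 0. ?f t > 0"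
    unfolding eventually_at_filter by (rule eventually_mono) simp
  moreover have "\<forall>\<^sub>F t in at_right (0::real). 0 < t" by (rule eventually_at_right_less)
  ultimately show ?thesis
    by eventually_elim (simp add: inner_stretch_line)
qed

lemma eventually_at_right_line_neg:
  assumes "v \<bullet> stretch l s p < 0"
  shows "\<forall>\<^sub>F t in at_right 0. (p + t *\<^sub>R v) \<bullet> stretch l s (p + t *\<^sub>R v) < p \<bullet> stretch l s p"
proof -
  let ?f = "\<lambda>t. - 2 * (v \<bullet> stretch l s p) - t * (v \<bullet> stretch l s v)"
  have "isCont ?f 0" by (intro continuous_intros)
  then have "\<forall>\<^sub>F t in nhds 0. ?f t > 0"
    by (rule eventually_nhds_greater) (use assms in simp)
  then have "\<forall>\<^sub>F t in at_right 0. ?f t > 0"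
    unfolding eventually_at_filter by (rule eventually_mono) simp
  moreover have "\<forall>\<^sub>F t in at_right (0::real). 0 < t" by (rule eventually_at_right_less)
  ultimately show ?thesis
    by eventually_elim (simp add: inner_stretch_line mult_pos_neg)
qed

text \<open>If \<open>T p\<close> had a component \<open>w\<close> orthogonal to \<open>\<nu>\<close>, the quadratic form would cross its level along the
  segment between \<open>p + t (K w - \<nu>)\<close> and \<open>p + t (- K w - \<nu>)\<close>, on which \<open>g < 0\<close>. This avoids curves in the
  level set.\<close>

lemma normal_parallel:
  fixes g :: "real^'n::finite \<Rightarrow> real"
  assumes U: "open U" "p \<in> U" and g0: "g p = 0"
    and level: "\<And>x. x \<in> U \<Longrightarrow> g x = 0 \<longleftrightarrow> x \<bullet> stretch l s x = p \<bullet> stretch l s p"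
    and g: "GDERIV g p :> \<mu> *\<^sub>R \<nu>" and \<mu>: "\<mu> > 0" and \<nu>: "norm \<nu> = 1"
  shows "stretch l s p = (\<nu> \<bullet> stretch l s p) *\<^sub>R \<nu>"
proof (rule ccontr)
  define n where "n = stretch l s p"
  define w where "w = n - (\<nu> \<bullet> n) *\<^sub>R \<nu>"
  assume "\<not> ?thesis"
  then have w0: "w \<noteq> 0" by (simp add: w_def n_def)
  have w\<nu>: "w \<bullet> \<nu> = 0" using \<nu> 
    by (simp add: w_def inner_diff_left norm_eq_1) (simp add: inner_commute)
  then have wn: "w \<bullet> n = w \<bullet> w" by (simp add: w_def inner_diff_right)
  have ww: "w \<bullet> w > 0" using w0 by simp
  \<comment> \<open>\<open>K\<close> is so large that the component along \<open>w\<close> outweighs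
    that along \<nu>, which gives the two end directions opposite first-order effects on the
    quadratic form.\<close>
  define K where "K = (\<bar>\<nu> \<bullet> n\<bar> + 1) / (w \<bullet> w)"
  have K: "K * (w \<bullet> n) = \<bar>\<nu> \<bullet> n\<bar> + 1" "K \<ge> 0" using ww by (auto simp: K_def wn)
  have "(K *\<^sub>R w - \<nu>) \<bullet> n > 0" "((- K) *\<^sub>R w - \<nu>) \<bullet> n < 0"
    using K by (auto simp: inner_diff_left)
  note ev = this(1)[unfolded n_def, THEN eventually_at_right_line_pos]
    this(2)[unfolded n_def, THEN eventually_at_right_line_neg]
  let ?x = "\<lambda>t k. p + t *\<^sub>R (k *\<^sub>R w - \<nu>)"
  let ?q = "\<lambda>x. x \<bullet> stretch l s x"
  obtain t where t: "\<And>k. \<bar>k\<bar> \<le> K \<Longrightarrow> ?x t k \<in> U \<and> g (?x t k) < 0"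
      "?q (?x t K) > ?q p" "?q (?x t (- K)) < ?q p"
    using eventually_happens'[OF trivial_limit_at_right_real
        eventually_conj[OF gderiv_neg_on_cone[OF g g0 \<mu> \<nu> w\<nu> U, of K] eventually_conj[OF ev]]]
    by auto
  have "continuous_on {- K..K} (\<lambda>k. ?q (?x t k))"
    by (intro continuous_intros)
  \<comment> \<open>A point of the segment on the level of \<open>p\<close> would have
    \<open>g\<close> zero by \<open>level\<close>, although \<open>g\<close> is negative on the
    whole segment.\<close>
  then have "\<exists>k\<ge>- K. k \<le> K \<and> ?q (?x t k) = ?q p"
    by (intro IVT') (use t K in simp_all)
  then obtain k where "- K \<le> k" "k \<le> K" and qk: "?q (?x t k) = ?q p"
    by blast
  then have "\<bar>k\<bar> \<le> K" by simp
  then show False using level[of "?x t k"] t(1)[of k] qk by simp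
qed

text \<open>Every null line through the vertex lies, near it, in the zero set of \<open>g\<close>,
  so the gradient is orthogonal to all null vectors. The null vectors
  \<open>axis l 1 + axis k 1\<close> and \<open>axis l 1 - axis k 1\<close> span the space. Thus the
  vertex of the cone has no outward unit normal.\<close>

lemma cone_vertex_gradient:
  fixes g :: "real^'n::finite \<Rightarrow> real"
  assumes U: "open U" "0 \<in> U" and n: "i \<noteq> l"
    and zero: "\<And>x. x \<in> U \<Longrightarrow> x \<bullet> stretch l (-1) x = 0 \<Longrightarrow> g x = 0"
    and g: "GDERIV g 0 :> \<nu>"
  shows "\<nu> = 0"
proof -
  have perp: "z \<bullet> \<nu> = 0" if z: "z \<bullet> stretch l (-1) z = 0" for z
  proof -
    have "isCont (\<lambda>t::real. t *\<^sub>R z) 0" by (intro continuous_intros)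
    then have "filterlim (\<lambda>t. t *\<^sub>R z) (nhds 0) (nhds (0::real))"
      using tendsto_at_iff_tendsto_nhds[of "\<lambda>t::real. t *\<^sub>R z" 0] by (simp add: isCont_def)
    from eventually_compose_filterlim[OF eventually_nhds_in_open[OF U] this]
    have "\<forall>\<^sub>F t in nhds 0. g (t *\<^sub>R z) = 0"
    proof eventually_elim
      case (elim t)
      show ?case
        using inner_stretch_line[of 0 t z l "-1"] z by (intro zero[OF elim]) (simp add: inner_stretch)
    qed
    moreover have "((\<lambda>t. g (0 + t *\<^sub>R z)) has_vector_derivative z \<bullet> \<nu>) (at 0)"
      by (rule has_vector_derivative_along_line) (use g in \<open>simp add: gderiv_def\<close>)
    then have "((\<lambda>t. g (t *\<^sub>R z)) has_real_derivative z \<bullet> \<nu>) (at 0)"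
      by (simp add: has_real_derivative_iff_has_vector_derivative)
    ultimately have "((\<lambda>t. 0) has_real_derivative z \<bullet> \<nu>) (at 0)"
      by (subst (asm) DERIV_cong_ev[OF refl _ refl, where g = "\<lambda>t. 0"])
    then show ?thesis using DERIV_const DERIV_unique by blast
  qed
  have comp: "\<nu> $ l + \<nu> $ k = 0 \<and> \<nu> $ l - \<nu> $ k = 0" if "k \<noteq> l" for k
  proof -
    have "(axis l 1 + axis k 1) \<bullet> \<nu> = 0" "(axis l 1 - axis k 1) \<bullet> \<nu> = 0"
      by (rule perp, use that in \<open>simp add: inner_stretch inner_add_left inner_add_right
           inner_diff_left inner_diff_right inner_axis_axis\<close>,
          simp add: axis_def)+
    then show ?thesis by (simp add: inner_add_left inner_diff_left inner_axis')
  qed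
  have "\<nu> $ k = 0" for k
    using comp[of k] comp[OF n] by (cases "k = l") auto
  then show ?thesis by (simp add: vec_eq_iff)
qed

text \<open>Suppose the sign were positive. Starting at a point of \<open>S\<close> near
  \<open>p\<close> and moving along \<nu>, the quantity \<open>\<sigma> * (q - k)\<close>, with
  \<open>q\<close> the quadratic form, starts positive and does not decrease, while \<open>g\<close>
  passes from negative to positive. The zero of \<open>g\<close> on the way would lie on the level
  \<open>k\<close>, a contradiction.\<close>

lemma outward_side:
  fixes g :: "real^'n::finite \<Rightarrow> real"
  assumes U: "open U" "p \<in> U" and g0: "g p = 0" and gc: "continuous_on U g"
    and level: "\<And>x. x \<in> U \<Longrightarrow> g x = 0 \<Longrightarrow> x \<bullet> stretch l s x = k"
    and g: "GDERIV g p :> \<mu> *\<^sub>R \<nu>" and \<mu>: "\<mu> > 0" and \<nu>: "norm \<nu> = 1"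
    and clos: "p \<in> closure S" and S: "\<And>x. x \<in> S \<inter> U \<Longrightarrow> g x < 0 \<and> \<sigma> * (x \<bullet> stretch l s x - k) > 0"
  shows "\<sigma> * (\<nu> \<bullet> stretch l s p) \<le> 0"
proof (rule ccontr)
  assume "\<not> ?thesis"
  then have pos: "\<sigma> * (\<nu> \<bullet> stretch l s p) > 0" by simp
  obtain r where r: "r > 0" "ball p r \<subseteq> U"
    using U open_contains_ball by blast
  have "((\<lambda>t. g (p + t *\<^sub>R \<nu>)) has_vector_derivative \<nu> \<bullet> (\<mu> *\<^sub>R \<nu>)) (at 0)"
    by (rule has_vector_derivative_along_line) (use g in \<open>simp add: gderiv_def\<close>)
  then have "((\<lambda>t. g (p + t *\<^sub>R \<nu>)) has_real_derivative \<mu>) (at 0)"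
    using \<nu> by (simp add: has_real_derivative_iff_has_vector_derivative norm_eq_1)
  then obtain d where d: "d > 0" "\<And>t. 0 < t \<Longrightarrow> t < d \<Longrightarrow> g (p + t *\<^sub>R \<nu>) > 0"
    using DERIV_pos_inc_right[of "\<lambda>t. g (p + t *\<^sub>R \<nu>)" \<mu> 0] \<mu> g0 by auto
  \<comment> \<open>\<open>b\<close> dominates the quadratic coefficient of the form along \<nu>.
    The length \<delta> keeps the segment in the ball around \<open>p\<close>, makes
    \<open>g\<close> positive at its far end for starting points near \<open>p\<close>, and keeps
    the quadratic term below the linear one.\<close>
  define b where "b = \<bar>\<sigma> * (\<nu> \<bullet> stretch l s \<nu>)\<bar> + 1"
  define \<delta> where "\<delta> = min (min (d / 2) (r / 2)) (\<sigma> * (\<nu> \<bullet> stretch l s p) / b)"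
  have b: "b > 0" by (simp add: b_def)
  have "\<delta> \<le> \<sigma> * (\<nu> \<bullet> stretch l s p) / b" by (simp add: \<delta>_def)
  then have "\<delta> * b \<le> \<sigma> * (\<nu> \<bullet> stretch l s p)" using b by (simp add: pos_le_divide_eq)
  moreover have "\<delta> > 0"
    using d(1) r(1) pos b by (simp add: \<delta>_def)
  moreover have "\<delta> \<le> d / 2" "\<delta> \<le> r / 2"
    unfolding \<delta>_def by linarith+
  ultimately have \<delta>: "\<delta> > 0" "\<delta> < d" "\<delta> < r" "\<delta> \<le> r / 2" "\<delta> * b \<le> \<sigma> * (\<nu> \<bullet> stretch l s p)"
    using d(1) r(1) by linarith+
  have "p + \<delta> *\<^sub>R \<nu> \<in> U"
    using \<delta> \<nu> by (intro subsetD[OF r(2)]) (simp add: dist_norm)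
  then have "isCont g (p + \<delta> *\<^sub>R \<nu>)"
    using gc U(1) continuous_on_eq_continuous_at by blast
  moreover have "isCont (\<lambda>x. x + \<delta> *\<^sub>R \<nu>) p"
    by (intro continuous_intros)
  ultimately have "isCont (\<lambda>x. g (x + \<delta> *\<^sub>R \<nu>)) p"
    by (rule isCont_o2[rotated])
  then have ev1: "\<forall>\<^sub>F x in nhds p. g (x + \<delta> *\<^sub>R \<nu>) > 0"
    by (rule eventually_nhds_greater) (use d(2) \<delta> in auto)
  have "isCont (\<lambda>x. \<sigma> * (\<nu> \<bullet> stretch l s x)) p"
    unfolding inner_stretch by (intro continuous_intros)
  then have ev2: "\<forall>\<^sub>F x in nhds p. \<sigma> * (\<nu> \<bullet> stretch l s x) > \<sigma> * (\<nu> \<bullet> stretch l s p) / 2"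
    by (rule eventually_nhds_greater) (use pos in simp)
  have ev3: "\<forall>\<^sub>F x in nhds p. x \<in> ball p (r / 2)"
    by (rule eventually_nhds_in_open) (use r(1) in auto)
  obtain W where W: "open W" "p \<in> W" "\<And>x. x \<in> W \<Longrightarrow> g (x + \<delta> *\<^sub>R \<nu>) > 0 \<and>
      \<sigma> * (\<nu> \<bullet> stretch l s x) > \<sigma> * (\<nu> \<bullet> stretch l s p) / 2 \<and> x \<in> ball p (r / 2)"
    using eventually_conj[OF ev1 eventually_conj[OF ev2 ev3]] unfolding eventually_nhds by metis
  obtain x where x: "x \<in> S" "x \<in> W"
    using clos W(1,2) open_Int_closure_eq_empty[of W S] by blast
  have line: "x + t *\<^sub>R \<nu> \<in> U" if "0 \<le> t" "t \<le> \<delta>" for t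
  proof (rule subsetD[OF r(2)])
    have "dist p (x + t *\<^sub>R \<nu>) \<le> dist p x + t"
      using that \<nu> dist_triangle[of p "x + t *\<^sub>R \<nu>" x] by (simp add: dist_norm)
    then show "x + t *\<^sub>R \<nu> \<in> ball p r" using W(3)[OF x(2)] \<delta>(4) that by simp
  qed
  have xU: "x \<in> U" using line[of 0] \<delta>(1) by simp
  have "continuous_on {0..\<delta>} (\<lambda>t. g (x + t *\<^sub>R \<nu>))"
    by (rule continuous_on_compose2[OF gc], intro continuous_intros) (use line in auto)
  then have "\<exists>t\<ge>0. t \<le> \<delta> \<and> g (x + t *\<^sub>R \<nu>) = 0"
    by (intro IVT') (use S x xU W(3)[OF x(2)] \<delta>(1) in \<open>auto intro: less_imp_le\<close>)
  then obtain t where t: "0 \<le> t" "t \<le> \<delta>" "g (x + t *\<^sub>R \<nu>) = 0" by blast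
  have "0 = \<sigma> * ((x + t *\<^sub>R \<nu>) \<bullet> stretch l s (x + t *\<^sub>R \<nu>) - k)"
    using level[OF line[OF t(1,2)] t(3)] by simp
  also have "\<dots> = \<sigma> * (x \<bullet> stretch l s x - k) +
      t * (2 * (\<sigma> * (\<nu> \<bullet> stretch l s x)) + t * (\<sigma> * (\<nu> \<bullet> stretch l s \<nu>)))"
    unfolding inner_stretch_line by (simp add: algebra_simps)
  also have "\<dots> > 0"
  proof -
    have "\<bar>t * (\<sigma> * (\<nu> \<bullet> stretch l s \<nu>))\<bar> \<le> \<delta> * b"
      unfolding abs_mult[of t] using t \<delta>(1) by (intro mult_mono) (auto simp: b_def)
    then have "2 * (\<sigma> * (\<nu> \<bullet> stretch l s x)) + t * (\<sigma> * (\<nu> \<bullet> stretch l s \<nu>)) \<ge> 0"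
      using W(3)[OF x(2)] \<delta>(5) by linarith
    then show ?thesis using S x(1) xU t(1) by (simp add: add_pos_nonneg)
  qed
  finally show False by simp
qed

text \<open>Fixes the direction and the sign of the gradient of the form relative to the outward
  normal; \<sigma> = 1 and \<sigma> = -1 stand for the two sides of the level. If both sides
  accumulate at \<open>p\<close>, the sign conditions on \<open>a\<close> contradict each
  other.\<close>

lemma outward_unit_normal_quadric:
  fixes \<Omega> :: "(real^'n::finite) set"
  assumes \<nu>: "outward_unit_normal \<Omega> p \<nu>" and p: "p \<in> frontier \<Omega>"
    and fr: "\<And>x. x \<in> frontier \<Omega> \<longleftrightarrow> x \<bullet> stretch l (-1) x = k" and n: "i \<noteq> l"
  obtains a where "a \<noteq> 0" "stretch l (-1) p = a *\<^sub>R \<nu>"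
    "\<And>\<sigma>. \<sigma> \<noteq> 0 \<Longrightarrow> p \<in> closure {x \<in> \<Omega>. \<sigma> * (x \<bullet> stretch l (-1) x - k) > 0} \<Longrightarrow> \<sigma> * a < 0"
proof -
  obtain U g \<mu> where U: "open U" "p \<in> U" and g: "smooth_on U g" "g p = 0"
    and gU: "\<Omega> \<inter> U = {x \<in> U. g x < 0}" "frontier \<Omega> \<inter> U = {x \<in> U. g x = 0}"
    and \<mu>: "\<mu> > 0" "GDERIV g p :> \<mu> *\<^sub>R \<nu>" and \<nu>1: "norm \<nu> = 1"
    using \<nu> unfolding outward_unit_normal_def by auto
  have level: "g x = 0 \<longleftrightarrow> x \<bullet> stretch l (-1) x = k" if "x \<in> U" for x
    using that gU(2) fr by blast
  have pk: "p \<bullet> stretch l (-1) p = k" using p fr by simp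
  define a where "a = \<nu> \<bullet> stretch l (-1) p"
  have par: "stretch l (-1) p = a *\<^sub>R \<nu>"
    unfolding a_def by (rule normal_parallel[OF U g(2) _ \<mu>(2,1) \<nu>1]) (use level pk in auto)
  have "a \<noteq> 0"
  proof
    assume "a = 0"
    \<comment> \<open>The form is nondegenerate, so a vanishing gradient forces \<open>p\<close> to
      be the vertex.\<close>
    then have B0: "stretch l (-1) p = 0" using par by simp
    moreover have "stretch l (-1) p $ l = - (p $ l)" by (simp add: stretch_def)
    ultimately have "p $ l = 0" by simp
    then have p0: "p = 0" using B0 by (simp add: stretch_def)
    have "\<mu> *\<^sub>R \<nu> = 0"
      by (rule cone_vertex_gradient[of U i l g]) (use U n level pk \<mu>(2) p0 in auto)
    then show False using \<mu>(1) \<nu>1 by auto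
  qed
  moreover have "\<sigma> * a < 0"
    if "\<sigma> \<noteq> 0" "p \<in> closure {x \<in> \<Omega>. \<sigma> * (x \<bullet> stretch l (-1) x - k) > 0}" for \<sigma>
  proof -
    have "\<sigma> * a \<le> 0"
      unfolding a_def
      by (rule outward_side[OF U g(2) smooth_on_imp_continuous_on[OF g(1)] _ \<mu>(2,1) \<nu>1 that(2), of l "-1" k])
        (use level gU(1) in auto)
    then show ?thesis using that(1) \<open>a \<noteq> 0\<close> by (simp add: order_less_le)
  qed
  ultimately show ?thesis using that par by blast
qed

section \<open>Boundary and interior behaviour in charts\<close>

lemma smooth_on_imp_differentiable_within:
  assumes X: "smooth_on V X" and y: "y \<in> V"
  shows "X differentiable (at y within V)"
proof -
  obtain U g where U: "open U" "y \<in> U" and g: "\<And>k. Ck_on k U g"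
    and gX: "\<And>z. z \<in> V \<inter> U \<Longrightarrow> g z = X z"
    using X[unfolded smooth_on_def, rule_format, OF y] by auto
  have "g differentiable_on U" using g[of "Suc 0"] by simp
  then have "g differentiable (at y)"
    using U by (metis at_within_open differentiable_on_def)
  then obtain D where "(g has_derivative D) (at y)"
    by (auto simp: differentiable_def)
  then have D: "(g has_derivative D) (at y within V)"
    by (rule has_derivative_at_withinI)
  obtain r where r: "r > 0" "ball y r \<subseteq> U"
    using U open_contains_ball by blast
  have "(X has_derivative D) (at y within V)"
    by (rule has_derivative_transform_within[OF D r(1) y]) (use r gX in \<open>auto simp: dist_commute subset_iff\<close>)
  then show ?thesis by (auto simp: differentiable_def)
qed

text \<open>Since \<open>w\<close> points out of the half-space, \<open>y - t *\<^sub>R w\<close>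
  moves into it. Its image has one-sided initial velocity \<open>- \<nu>\<close>, so the form has
  derivative \<open>- 2 * (\<nu> \<bullet> stretch l s (X y))\<close> there, whose sign decides
  between growth and decay.\<close>

lemma inward_curve:
  fixes X :: "real^'d::finite \<Rightarrow> real^'n::finite"
  assumes V: "openin (top_of_set (half_space j)) V" and y: "y \<in> V"
    and X: "smooth_on V X" and w: "w $ j < 0"
  defines "\<nu> \<equiv> frechet_derivative X (at y within V) w"
  shows "\<forall>\<^sub>F t in at_right 0. y - t *\<^sub>R w \<in> V"
    and "\<nu> \<bullet> stretch l s (X y) < 0 \<Longrightarrow> \<forall>\<^sub>F t in at_right 0.
      X y \<bullet> stretch l s (X y) < X (y - t *\<^sub>R w) \<bullet> stretch l s (X (y - t *\<^sub>R w))"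
    and "\<nu> \<bullet> stretch l s (X y) > 0 \<Longrightarrow> \<forall>\<^sub>F t in at_right 0.
      X y \<bullet> stretch l s (X y) > X (y - t *\<^sub>R w) \<bullet> stretch l s (X (y - t *\<^sub>R w))"
proof -
  obtain T where T: "open T" "V = half_space j \<inter> T"
    using V by (auto simp: openin_open)
  then obtain r where r: "r > 0" "ball y r \<subseteq> T"
    using y open_contains_ball by blast
  define \<epsilon> where "\<epsilon> = r / (norm w + 1)"
  have \<epsilon>: "\<epsilon> > 0" using r(1) by (simp add: \<epsilon>_def add_nonneg_pos)
  have inV: "y - t *\<^sub>R w \<in> V" if t: "0 \<le> t" "t < \<epsilon>" for t
  proof -
    have "t * norm w \<le> t * (norm w + 1)" using t by (intro mult_left_mono) auto
    also have "\<dots> < r" using t(2) by (simp add: \<epsilon>_def pos_less_divide_eq add_nonneg_pos)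
    finally have "y - t *\<^sub>R w \<in> T" using t(1) by (intro subsetD[OF r(2)]) (simp add: dist_norm)
    moreover have "t * w $ j \<le> 0" using t(1) w by (simp add: mult_nonneg_nonpos)
    then have "y - t *\<^sub>R w \<in> half_space j"
      using y T(2) by (auto simp: half_space_def)
    ultimately show ?thesis using T(2) by blast
  qed
  have small: "\<forall>\<^sub>F t in at_right 0. t < d" if "d > 0" for d :: real
    using that by (auto intro: eventually_at_rightI)
  have pos: "\<forall>\<^sub>F t in at_right (0::real). 0 < t" by (rule eventually_at_right_less)
  show "\<forall>\<^sub>F t in at_right 0. y - t *\<^sub>R w \<in> V"
    using pos small[OF \<epsilon>] by eventually_elim (simp add: inV)
  let ?X' = "frechet_derivative X (at y within V)" and ?S = "{0..<\<epsilon>}"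
  let ?\<gamma> = "\<lambda>t. X (y - t *\<^sub>R w)"
  have X': "(X has_derivative ?X') (at y within V)"
    using smooth_on_imp_differentiable_within[OF X y] frechet_derivative_works by blast
  \<comment> \<open>The chain rule is applied on a one-sided interval because \<open>X\<close> is
    differentiable only within \<open>V\<close>.\<close>
  have "((\<lambda>t. y - t *\<^sub>R w) has_derivative (\<lambda>h. - (h *\<^sub>R w))) (at 0 within ?S)"
    by (auto intro!: derivative_eq_intros)
  moreover have "(X has_derivative ?X') (at (y - 0 *\<^sub>R w) within (\<lambda>t. y - t *\<^sub>R w) ` ?S)"
    using inV by (auto intro!: has_derivative_subset[OF X'])
  ultimately have "(?\<gamma> has_derivative (\<lambda>h. ?X' (- (h *\<^sub>R w)))) (at 0 within ?S)"
    by (rule has_derivative_in_compose)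
  moreover have "?X' (- (h *\<^sub>R w)) = h *\<^sub>R (- \<nu>)" for h
    using has_derivative_linear[OF X'] by (simp add: \<nu>_def linear_neg linear_cmul)
  ultimately have \<gamma>: "(?\<gamma> has_vector_derivative - \<nu>) (at 0 within ?S)"
    by (simp add: has_vector_derivative_def)
  have H: "((\<lambda>t. ?\<gamma> t \<bullet> stretch l s (?\<gamma> t)) has_real_derivative - 2 * (\<nu> \<bullet> stretch l s (X y))) (at 0 within ?S)"
    using has_real_derivative_inner_stretch[OF \<gamma> \<gamma>, of l s] by simp
  show "\<forall>\<^sub>F t in at_right 0. X y \<bullet> stretch l s (X y) < ?\<gamma> t \<bullet> stretch l s (?\<gamma> t)"
    if neg: "\<nu> \<bullet> stretch l s (X y) < 0"
  proof -
    obtain d where d: "d > 0" "\<And>t. 0 < t \<Longrightarrow> 0 + t \<in> ?S \<Longrightarrow> t < d \<Longrightarrow>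
        ?\<gamma> 0 \<bullet> stretch l s (?\<gamma> 0) < ?\<gamma> (0 + t) \<bullet> stretch l s (?\<gamma> (0 + t))"
      using has_real_derivative_pos_inc_right[OF H] neg by auto
    show ?thesis
      using pos small[OF \<epsilon>] small[OF d(1)] by eventually_elim (use d(2) in simp)
  qed
  show "\<forall>\<^sub>F t in at_right 0. X y \<bullet> stretch l s (X y) > ?\<gamma> t \<bullet> stretch l s (?\<gamma> t)"
    if neg: "\<nu> \<bullet> stretch l s (X y) > 0"
  proof -
    obtain d where d: "d > 0" "\<And>t. 0 < t \<Longrightarrow> 0 + t \<in> ?S \<Longrightarrow> t < d \<Longrightarrow>
        ?\<gamma> 0 \<bullet> stretch l s (?\<gamma> 0) > ?\<gamma> (0 + t) \<bullet> stretch l s (?\<gamma> (0 + t))"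
      using has_real_derivative_neg_dec_right[OF H] neg by auto
    show ?thesis
      using pos small[OF \<epsilon>] small[OF d(1)] by eventually_elim (use d(2) in simp)
  qed
qed

text \<open>The continuous local expressions are glued over the atlas; this makes the image of a
  compact hypersurface compact.\<close>

lemma continuous_map_immersion:
  assumes "immersed_hypersurface j M A f"
  shows "continuous_map M euclidean f"
proof (rule pasting_lemma[where I = A and T = fst and f = "\<lambda>_. f"])
  have atlas: "smooth_atlas j M A"
    using assms by (auto simp: immersed_hypersurface_def manifold_with_boundary_def)
  show "openin M (fst C)" if "C \<in> A" for C
    using atlas that by (auto simp: smooth_atlas_def is_chart_def)
  show "\<exists>C. C \<in> A \<and> x \<in> fst C \<and> f x = f x" if "x \<in> topspace M" for x
    using atlas that by (force simp: smooth_atlas_def)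
  show "continuous_map (subtopology M (fst C)) euclidean f" if "C \<in> A" for C
  proof -
    obtain U \<phi> where C: "C = (U, \<phi>)" by (cases C)
    have \<phi>: "homeomorphic_map (subtopology M U) (top_of_set (\<phi> ` U)) \<phi>" and U: "openin M U"
      using atlas that by (auto simp: smooth_atlas_def is_chart_def C)
    have "smooth_on (\<phi> ` U) (local_expr (U, \<phi>) f)"
      using assms that by (auto simp: immersed_hypersurface_def C)
    then have "continuous_map (top_of_set (\<phi> ` U)) euclidean (local_expr (U, \<phi>) f)"
      using smooth_on_imp_continuous_on by auto
    then have "continuous_map (subtopology M U) euclidean (local_expr (U, \<phi>) f \<circ> \<phi>)"
      using \<phi> continuous_map_compose homeomorphic_imp_continuous_map by blast
    moreover have "(local_expr (U, \<phi>) f \<circ> \<phi>) x = f x" if "x \<in> topspace (subtopology M U)" for x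
    proof -
      have "inj_on \<phi> U"
        using homeomorphic_imp_injective_map[OF \<phi>] openin_subset[OF U] by (simp add: Int_absorb1)
      then show ?thesis using that by (simp add: local_expr_def)
    qed
    ultimately have "continuous_map (subtopology M U) euclidean f"
      by (rule continuous_map_eq)
    then show ?thesis by (simp add: C)
  qed
qed simp

text \<open>Where \<open>stretch l (-1) x\<close> is a multiple of the conormal, the left side is
  that multiple of the conormal component of \<open>stretch l s x\<close>; the formula thus gives
  the sign of the boundary derivative.\<close>

lemma inner_stretch_stretch:
  "stretch l s x \<bullet> stretch l (-1) x = x \<bullet> stretch l (-1) x - (s - 1) * (x $ l)\<^sup>2"
proof -
  have "stretch l s x \<bullet> stretch l (-1) x = stretch l s x \<bullet> x - 2 * (stretch l s x) $ l * x $ l"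
    by (simp add: inner_stretch)
  also have "\<dots> = x \<bullet> stretch l s x - 2 * (stretch l s x) $ l * x $ l"
    by (simp add: inner_commute)
  also have "\<dots> = x \<bullet> stretch l (-1) x - (s - 1) * (x $ l)\<^sup>2"
    by (simp add: inner_stretch) (simp add: stretch_def algebra_simps power2_eq_square)
  finally show ?thesis .
qed

lemma square_component_le_inner: "(x $ l)\<^sup>2 \<le> x \<bullet> (x :: real^'n::finite)"
  using power_mono[OF component_le_norm_cart[of x l], of 2] by (simp add: power2_norm_eq_inner)

lemma chart_local_expr:
  assumes M: "immersed_hypersurface j M A f" and C: "(U, \<phi>) \<in> A"
  shows "openin (top_of_set (half_space j)) (\<phi> ` U)"
    and "smooth_on (\<phi> ` U) (local_expr (U, \<phi>) f)"
    and "\<And>y. y \<in> \<phi> ` U \<Longrightarrow> inj (frechet_derivative (local_expr (U, \<phi>) f) (at y within \<phi> ` U))"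
    and "\<And>p. p \<in> U \<Longrightarrow> local_expr (U, \<phi>) f (\<phi> p) = f p"
    and "local_expr (U, \<phi>) f ` \<phi> ` U \<subseteq> f ` topspace M"
proof -
  have "is_chart j M (U, \<phi>)"
    using M C by (auto simp: immersed_hypersurface_def manifold_with_boundary_def smooth_atlas_def)
  then have U: "openin M U" "homeomorphic_map (subtopology M U) (top_of_set (\<phi> ` U)) \<phi>"
    and V: "openin (top_of_set (half_space j)) (\<phi> ` U)"
    by (auto simp: is_chart_def)
  have "inj_on \<phi> U"
    using homeomorphic_imp_injective_map[OF U(2)] openin_subset[OF U(1)] by (simp add: Int_absorb1)
  then show *: "local_expr (U, \<phi>) f (\<phi> p) = f p" if "p \<in> U" for p
    using that by (simp add: local_expr_def)
  show "local_expr (U, \<phi>) f ` \<phi> ` U \<subseteq> f ` topspace M"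
    using * openin_subset[OF U(1)] by auto
  show "openin (top_of_set (half_space j)) (\<phi> ` U)" by (rule V)
  show "smooth_on (\<phi> ` U) (local_expr (U, \<phi>) f)"
    "\<And>y. y \<in> \<phi> ` U \<Longrightarrow> inj (frechet_derivative (local_expr (U, \<phi>) f) (at y within \<phi> ` U))"
    using M C by (auto simp: immersed_hypersurface_def)
qed

text \<open>Lying strictly on one side of the level is an open condition, so a chart neighbourhood
  of \<open>p\<close> is mapped into \<open>E\<close>. A maximum over \<open>E\<close> would
  therefore be a local maximum in an interior chart point.\<close>

lemma no_interior_max_on_side:
  assumes min: "minimal_hypersurface j M A f" and d: "CARD('d::finite) \<ge> 2" and s: "s \<ge> 0"
    and C: "((U, \<phi>) :: ('m, 'd) chart) \<in> A" and p: "p \<in> U" "\<phi> p $ j \<noteq> 0"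
    and E: "E = {x \<in> f ` topspace M. \<sigma> * (x \<bullet> stretch l s' x - k) > 0}" and pE: "f p \<in> E"
  shows "\<not> (\<forall>x\<in>E. x \<bullet> stretch l s x \<le> f p \<bullet> stretch l s (f p))"
proof
  assume max: "\<forall>x\<in>E. x \<bullet> stretch l s x \<le> f p \<bullet> stretch l s (f p)"
  have M: "immersed_hypersurface j M A f"
    using min by (simp add: minimal_hypersurface_def)
  note c = chart_local_expr[OF M C]
  define V X y where "V = \<phi> ` U" and "X = local_expr (U, \<phi>) f" and "y = \<phi> p"
  have y: "y \<in> V" and Xy: "X y = f p" using p(1) c(4) by (auto simp: V_def y_def X_def)
  obtain T where T: "open T" "V = half_space j \<inter> T"
    using c(1) by (auto simp: openin_open V_def)
  have "y \<in> interior V"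
  proof (rule interiorI)
    show "open (T \<inter> {z. 0 < z $ j})"
      using T(1) by (intro open_Int open_Collect_less continuous_intros)
    show "y \<in> T \<inter> {z. 0 < z $ j}" using y T(2) p(2) by (auto simp: half_space_def y_def)
    show "T \<inter> {z. 0 < z $ j} \<subseteq> V" by (auto simp: T(2) half_space_def)
  qed
  then have yi: "y \<in> interior V" .
  have X: "smooth_on V X" using c(2) by (simp add: V_def X_def)
  have "isCont X y"
    using continuous_on_interior[OF smooth_on_imp_continuous_on[OF X] yi] .
  then have "isCont (\<lambda>z. \<sigma> * (X z \<bullet> stretch l s' (X z) - k)) y"
    unfolding inner_stretch by (intro continuous_intros)
  then have "\<forall>\<^sub>F z in nhds y. \<sigma> * (X z \<bullet> stretch l s' (X z) - k) > 0"
    by (rule eventually_nhds_greater) (use pE E Xy in auto)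
  moreover have "\<forall>\<^sub>F z in nhds y. z \<in> interior V"
    using yi by (intro eventually_nhds_in_open) auto
  ultimately have "\<forall>\<^sub>F z in nhds y. X z \<bullet> stretch l s (X z) \<le> X y \<bullet> stretch l s (X y)"
  proof eventually_elim
    case (elim z)
    then have "X z \<in> f ` topspace M"
      using c(5) interior_subset[of V] unfolding X_def V_def by blast
    then have "X z \<in> E" using elim by (simp add: E)
    then show ?case using max Xy by simp
  qed
  moreover have "\<not> (\<forall>\<^sub>F z in nhds y. X z \<bullet> stretch l s (X z) \<le> X y \<bullet> stretch l s (X y))"
    by (rule minimal_imp_no_interior_local_max[OF d s X yi])
      (use c(3) y min C in \<open>auto simp: V_def X_def minimal_hypersurface_def\<close>)
  ultimately show False by blast
qed

section \<open>The global argument on the image of the hypersurface\<close>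

theorem theorem3:
  fixes F :: "real^'n::finite \<Rightarrow> real" and c :: real and l :: 'n
    and \<Omega> :: "(real^'n) set" and j :: "'d::finite"
  assumes "CARD('n) \<ge> 3"
    and "\<And>x. F x = (\<Sum>i\<in>UNIV - {l}. (x $ i)^2) - (x $ l)^2 + c"
    and "c \<ge> 1"
    and "open \<Omega>"
    and "frontier \<Omega> = F -` {1}"
  shows "\<not> (\<exists>(M :: 'm topology) (A :: ('m, 'd) chart set) (f :: 'm \<Rightarrow> real^'n).
            compact_free_boundary_minimal_hypersurface j M A f \<Omega>)"
proof
  assume "\<exists>(M :: 'm topology) (A :: ('m, 'd) chart set) (f :: 'm \<Rightarrow> real^'n).
            compact_free_boundary_minimal_hypersurface j M A f \<Omega>"
  then obtain M :: "'m topology" and A :: "('m, 'd) chart set" and f :: "'m \<Rightarrow> real^'n"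
    where comp: "compact_space M" and min: "minimal_hypersurface j M A f"
      and cont: "contained_up_to_boundary j M A f \<Omega>" and free: "free_boundary j A f \<Omega>"
    unfolding compact_free_boundary_minimal_hypersurface_def by blast
  have M: "immersed_hypersurface j M A f"
    using min by (simp add: minimal_hypersurface_def)
  then have d: "CARD('d) \<ge> 2" and ne: "topspace M \<noteq> {}"
    and atlas: "(\<Union>(U, \<phi>)\<in>A. U) = topspace M"
    using assms(1) unfolding immersed_hypersurface_def manifold_with_boundary_def smooth_atlas_def
    by simp_all
  have cover: "\<exists>U \<phi>. (U, \<phi>) \<in> A \<and> p \<in> U" if "p \<in> topspace M" for p
    using that unfolding atlas[symmetric] by blast
  have "UNIV \<noteq> {l}"
    using assms(1) by (metis One_nat_def card.empty card.insert empty_iff finite.emptyI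
        numeral_le_one_iff semiring_norm(70))
  then obtain i where i: "i \<noteq> l" by blast
  define q where "q = (\<lambda>x. x \<bullet> stretch l (-1) x)"
  define k where "k = 1 - c"
  have k: "k \<le> 0" using assms(3) by (simp add: k_def)
  have "F x = q x + c" for x
  proof -
    have "x \<bullet> x = (x $ l)^2 + (\<Sum>i\<in>UNIV - {l}. (x $ i)^2)"
      unfolding inner_vec_def by (subst sum.remove[of _ l]) (auto simp: power2_eq_square)
    then show ?thesis by (simp add: assms(2) q_def inner_stretch power2_eq_square)
  qed
  then have fr: "x \<in> frontier \<Omega> \<longleftrightarrow> q x = k" for x
    by (auto simp: assms(5) k_def)
  define S where "S = f ` topspace M"
  have S: "compact S"
    using image_compactin[OF comp[unfolded compact_space_def] continuous_map_immersion[OF M]]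
    by (simp add: S_def)
  \<comment> \<open>Because \<Omega> is open it misses its frontier, so the image point alone tells
    boundary points from interior ones.\<close>
  have bdry: "p \<in> manifold_boundary j A \<longleftrightarrow> q (f p) = k" if "p \<in> topspace M" for p
  proof -
    have "\<Omega> \<inter> frontier \<Omega> = {}"
      using assms(4) by (simp add: frontier_def interior_open)
    then show ?thesis using cont that fr by (auto simp: contained_up_to_boundary_def)
  qed
  define E where "E = (\<lambda>\<sigma>. {x \<in> S. \<sigma> * (q x - k) > 0})"
  have E\<Omega>: "E \<sigma> \<subseteq> {x \<in> \<Omega>. \<sigma> * (q x - k) > 0}" for \<sigma>
  proof
    fix x assume x: "x \<in> E \<sigma>"
    then obtain p where p: "p \<in> topspace M" "x = f p" by (auto simp: E_def S_def)
    then have "p \<notin> manifold_boundary j A" using bdry x by (auto simp: E_def)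
    then show "x \<in> {x \<in> \<Omega>. \<sigma> * (q x - k) > 0}"
      using cont p x by (auto simp: contained_up_to_boundary_def E_def)
  qed
  have interior: "\<exists>z\<in>E \<sigma>. z \<bullet> stretch l s z > x \<bullet> stretch l s x"
    if x: "x \<in> E \<sigma>" and s: "s \<ge> 0" for x \<sigma> s
  proof -
    obtain p where p: "p \<in> topspace M" "x = f p" using x by (auto simp: E_def S_def)
    then have nb: "p \<notin> manifold_boundary j A" using bdry x by (auto simp: E_def)
    obtain U \<phi> where C: "(U, \<phi>) \<in> A" "p \<in> U" using cover[OF p(1)] by blast
    then have "\<phi> p $ j \<noteq> 0" using nb by (auto simp: manifold_boundary_def)
    from no_interior_max_on_side[OF min d s C this _ x[unfolded p(2)], of \<sigma> l "-1" k]
    show ?thesis by (force simp: E_def q_def S_def p(2) not_le)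
  qed
  \<comment> \<open>The curve \<gamma> does not depend on \<open>s\<close>: with
    \<open>s = -1\<close> it shows which side of the level is entered, with the \<open>s\<close> of
    that side it tests the maximality of the form.\<close>
  have boundary: "\<exists>\<nu> a \<gamma>. a \<noteq> 0 \<and> norm \<nu> = 1 \<and> stretch l (-1) x = a *\<^sub>R \<nu> \<and>
      (\<forall>\<sigma>. \<sigma> \<noteq> 0 \<longrightarrow> x \<in> closure (E \<sigma>) \<longrightarrow> \<sigma> * a < 0) \<and>
      (\<forall>\<^sub>F t in at_right (0::real). \<gamma> t \<in> S) \<and>
      (\<forall>s. (\<nu> \<bullet> stretch l s x < 0 \<longrightarrow>
             (\<forall>\<^sub>F t in at_right 0. x \<bullet> stretch l s x < \<gamma> t \<bullet> stretch l s (\<gamma> t))) \<and>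
           (\<nu> \<bullet> stretch l s x > 0 \<longrightarrow>
             (\<forall>\<^sub>F t in at_right 0. x \<bullet> stretch l s x > \<gamma> t \<bullet> stretch l s (\<gamma> t))))"
    if x: "x \<in> S" "q x = k" for x
  proof -
    obtain p where p: "p \<in> topspace M" "x = f p" using x by (auto simp: S_def)
    then have "p \<in> manifold_boundary j A" using bdry x by auto
    then obtain U \<phi> where C: "(U, \<phi>) \<in> A" "p \<in> U" "\<phi> p $ j = 0"
      by (auto simp: manifold_boundary_def)
    note c = chart_local_expr[OF M C(1)]
    let ?X = "local_expr (U, \<phi>) f"
    obtain \<nu> where \<nu>: "outward_unit_conormal j (\<phi> ` U) ?X (\<phi> p) \<nu>" "outward_unit_normal \<Omega> x \<nu>"
      using free C p(2) unfolding free_boundary_def by blast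
    then obtain w where w: "w $ j < 0" "\<nu> = frechet_derivative ?X (at (\<phi> p) within \<phi> ` U) w"
      by (auto simp: outward_unit_conormal_def)
    obtain a where a: "a \<noteq> 0" "stretch l (-1) x = a *\<^sub>R \<nu>"
      "\<And>\<sigma>. \<sigma> \<noteq> 0 \<Longrightarrow> x \<in> closure {x \<in> \<Omega>. \<sigma> * (x \<bullet> stretch l (-1) x - k) > 0} \<Longrightarrow> \<sigma> * a < 0"
      by (rule outward_unit_normal_quadric[OF \<nu>(2) _ fr[unfolded q_def] i])
        (use fr x(2) that in auto)
    have "x \<in> closure (E \<sigma>) \<Longrightarrow> \<sigma> * a < 0" if "\<sigma> \<noteq> 0" for \<sigma>
      using a(3)[OF that] closure_mono[OF E\<Omega>[of \<sigma>]] by (auto simp: q_def)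
    moreover have "\<phi> p \<in> \<phi> ` U" using C(2) by simp
    note curve = inward_curve[OF c(1) this c(2) w(1), folded w(2), unfolded c(4)[OF C(2)], folded p(2)]
    have "\<forall>\<^sub>F t in at_right 0. ?X (\<phi> p - t *\<^sub>R w) \<in> S"
      using curve(1) by eventually_elim (use c(5) in \<open>auto simp: S_def\<close>)
    moreover have "norm \<nu> = 1" using \<nu>(1) by (simp add: outward_unit_conormal_def)
    ultimately show ?thesis
      using a(1,2) curve(2,3)
      by (intro exI[of _ \<nu>] exI[of _ a] exI[of _ "\<lambda>t. ?X (\<phi> p - t *\<^sub>R w)"]) blast
  qed
  have empty: "E \<sigma> = {}" if \<sigma>: "(\<sigma>, s) = (1, 0) \<or> (\<sigma>, s) = (-1, 2)" for \<sigma> s :: real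
  proof (rule ccontr)
    assume nonempty: "E \<sigma> \<noteq> {}"
    have s: "s \<ge> 0" and \<sigma>0: "\<sigma> \<noteq> 0" using \<sigma> by auto
    have sub: "closure (E \<sigma>) \<subseteq> S"
      by (rule closure_minimal) (auto simp: E_def compact_imp_closed S)
    have "compact (closure (E \<sigma>))"
      using sub S by (metis closed_closure compact_Int_closed inf.absorb_iff2)
    moreover have "closure (E \<sigma>) \<noteq> {}" using nonempty by simp
    moreover have "continuous_on (closure (E \<sigma>)) (\<lambda>x. x \<bullet> stretch l s x)"
      by (intro continuous_intros)
    ultimately obtain x where x: "x \<in> closure (E \<sigma>)"
      and max: "\<And>z. z \<in> closure (E \<sigma>) \<Longrightarrow> z \<bullet> stretch l s z \<le> x \<bullet> stretch l s x"
      using continuous_attains_sup by metis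
    have maxE: "z \<bullet> stretch l s z \<le> x \<bullet> stretch l s x" if "z \<in> E \<sigma>" for z
      using max that closure_subset by blast
    \<comment> \<open>The maximum over the compact closure cannot be attained in
      \<open>E \<sigma>\<close> itself, which leaves only the level set.\<close>
    have xE: "x \<notin> E \<sigma>" using interior[OF _ s, of x \<sigma>] maxE by (meson not_le)
    have "closed {x. \<sigma> * (q x - k) \<ge> 0}"
      unfolding q_def by (intro closed_Collect_le continuous_intros)
    then have "closure (E \<sigma>) \<subseteq> {x. \<sigma> * (q x - k) \<ge> 0}"
      by (intro closure_minimal) (auto simp: E_def)
    then have "\<sigma> * (q x - k) \<ge> 0" using x by blast
    moreover have xS: "x \<in> S" using x sub by blast
    ultimately have qx: "q x = k" using xE \<sigma>0 by (auto simp: E_def)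
    obtain \<nu> a \<gamma> where a: "a \<noteq> 0" "norm \<nu> = 1" "stretch l (-1) x = a *\<^sub>R \<nu>" "\<sigma> * a < 0"
      and \<gamma>: "\<forall>\<^sub>F t in at_right (0::real). \<gamma> t \<in> S"
      and inc: "\<And>s. \<nu> \<bullet> stretch l s x < 0 \<Longrightarrow>
             \<forall>\<^sub>F t in at_right 0. x \<bullet> stretch l s x < \<gamma> t \<bullet> stretch l s (\<gamma> t)"
      and dec: "\<And>s. \<nu> \<bullet> stretch l s x > 0 \<Longrightarrow>
             \<forall>\<^sub>F t in at_right 0. x \<bullet> stretch l s x > \<gamma> t \<bullet> stretch l s (\<gamma> t)"
      using boundary[OF xS qx] x \<sigma>0 by blast
    have "\<nu> \<bullet> stretch l (-1) x = a" using a(2,3) by (simp add: norm_eq_1)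
    \<comment> \<open>The form with \<open>s = -1\<close> is \<open>q\<close>, and its conormal
      component is \<open>a\<close>. As \<open>\<sigma> * a < 0\<close>, the inward curve enters the
      side \<sigma>, where \<open>x\<close> is maximal.\<close>
    then have "\<forall>\<^sub>F t in at_right 0. \<sigma> * (q (\<gamma> t) - k) > 0"
    proof (cases "\<sigma> = 1")
      case True
      then show ?thesis
        using inc[of "-1"] a(4) \<open>\<nu> \<bullet> stretch l (-1) x = a\<close> qx by (simp add: q_def)
    next
      case False
      then have "\<sigma> = -1" using \<sigma> by auto
      then show ?thesis
        using dec[of "-1"] a(4) \<open>\<nu> \<bullet> stretch l (-1) x = a\<close> qx by (simp add: q_def)
    qed
    with \<gamma> have \<gamma>E: "\<forall>\<^sub>F t in at_right 0. \<gamma> t \<in> E \<sigma>"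
      by eventually_elim (simp add: E_def)
    have "\<nu> \<bullet> stretch l s x \<ge> 0"
    proof (rule ccontr)
      assume "\<not> ?thesis"
      then have "\<forall>\<^sub>F t in at_right 0. x \<bullet> stretch l s x < \<gamma> t \<bullet> stretch l s (\<gamma> t)"
        by (intro inc) simp
      then obtain t where "\<gamma> t \<in> E \<sigma>" "x \<bullet> stretch l s x < \<gamma> t \<bullet> stretch l s (\<gamma> t)"
        using eventually_happens'[OF trivial_limit_at_right_real eventually_conj[OF \<gamma>E]] by blast
      then show False using maxE[of "\<gamma> t"] by simp
    qed
    moreover have "stretch l s x \<bullet> stretch l (-1) x = a * (\<nu> \<bullet> stretch l s x)"
      by (simp add: a(3) inner_commute)
    then have key: "q x - (s - 1) * (x $ l)\<^sup>2 = a * (\<nu> \<bullet> stretch l s x)"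
      by (simp add: inner_stretch_stretch q_def)
    \<comment> \<open>Maximality makes the conormal component of \<open>stretch l s x\<close>
      nonnegative, and multiplying it by the negative number \<open>\<sigma> * a\<close> reverses
      the sign.\<close>
    ultimately have sign: "\<sigma> * (q x - (s - 1) * (x $ l)\<^sup>2) \<le> 0"
      using a(4) by (simp add: mult_nonpos_nonneg flip: mult.assoc)
    have qx': "q x = x \<bullet> x - 2 * (x $ l)\<^sup>2"
      by (simp add: q_def inner_stretch power2_eq_square)
    show False
    proof (cases "\<sigma> = 1")
      case True
      then have s0: "s = 0" using \<sigma> by auto
      \<comment> \<open>For \<open>s = 0\<close> the expression in \<open>sign\<close> is the form
        itself. The form is nonnegative everywhere, so every point of \<open>E \<sigma>\<close>
        attains the maximum, against \<open>interior\<close>.\<close>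
      then have "x \<bullet> stretch l s x \<le> 0"
        using sign True qx' by (simp add: inner_stretch power2_eq_square)
      moreover obtain e where e: "e \<in> E \<sigma>" using nonempty by blast
      moreover have "e \<bullet> stretch l s e \<ge> 0"
        using square_component_le_inner[of e l] s0 by (simp add: inner_stretch power2_eq_square)
      ultimately have "\<And>z. z \<in> E \<sigma> \<Longrightarrow> z \<bullet> stretch l s z \<le> e \<bullet> stretch l s e"
        using maxE by fastforce
      then show False using interior[OF e s] by (meson not_le)
    next
      case False
      then have "\<sigma> = -1" "s = 2" using \<sigma> by auto
      \<comment> \<open>Here c \<ge> 1 enters: k \<le> 0 leaves only the vertex of the cone, where
        the gradient would vanish although \<open>a\<close> and \<nu> do not.\<close>
      then have "(x $ l)\<^sup>2 \<le> k" using sign qx by simp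
      then have "(x $ l)\<^sup>2 = 0" "k = 0" using k zero_le_power2[of "x $ l"] by linarith+
      then have "x = 0" using qx qx' by simp
      then have "a *\<^sub>R \<nu> = 0" using a(3) by (simp add: stretch_def)
      then show False using a(1,2) by auto
    qed
  qed
  obtain p where p: "p \<in> topspace M" using ne by blast
  then have pS: "f p \<in> S" by (simp add: S_def)
  have S_level: "q x = k" if "x \<in> S" for x
  proof (rule ccontr)
    assume "q x \<noteq> k"
    then have "x \<in> E 1 \<or> x \<in> E (-1)" using that by (auto simp: E_def)
    then show False using empty[of 1 0] empty[of "-1" 2] by auto
  qed
  \<comment> \<open>The image now lies in the level set. Free boundary at any of its points rules
    this out: \<open>q\<close> has nonzero derivative along the inward curve, which stays in the
    image but leaves the level.\<close>
  obtain \<nu> a \<gamma> where a: "a \<noteq> 0" "norm \<nu> = 1" "stretch l (-1) (f p) = a *\<^sub>R \<nu>"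
    and \<gamma>: "\<forall>\<^sub>F t in at_right (0::real). \<gamma> t \<in> S"
    and inc: "\<nu> \<bullet> stretch l (-1) (f p) < 0 \<Longrightarrow> \<forall>\<^sub>F t in at_right 0. q (f p) < q (\<gamma> t)"
    and dec: "\<nu> \<bullet> stretch l (-1) (f p) > 0 \<Longrightarrow> \<forall>\<^sub>F t in at_right 0. q (f p) > q (\<gamma> t)"
    using boundary[OF pS S_level[OF pS]] unfolding q_def by blast
  have "\<nu> \<bullet> stretch l (-1) (f p) = a" using a(2,3) by (simp add: norm_eq_1)
  then have "\<nu> \<bullet> stretch l (-1) (f p) < 0 \<or> \<nu> \<bullet> stretch l (-1) (f p) > 0"
    using a(1) by linarith
  then have "\<forall>\<^sub>F t in at_right 0. q (f p) \<noteq> q (\<gamma> t)"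
  proof
    assume "\<nu> \<bullet> stretch l (-1) (f p) < 0"
    from inc[OF this] show ?thesis by eventually_elim simp
  next
    assume "\<nu> \<bullet> stretch l (-1) (f p) > 0"
    from dec[OF this] show ?thesis by eventually_elim simp
  qed
  then obtain t where "\<gamma> t \<in> S" "q (f p) \<noteq> q (\<gamma> t)"
    using eventually_happens'[OF trivial_limit_at_right_real eventually_conj[OF \<gamma>]] by blast
  then show False using S_level pS by simp
qed

end
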